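(* Let $q$ be a prime power, let $k\le n$ and $\ell$ be positive integers, put $R=k/n$, and let $V\subseteq\mathbb F_{q^n}$ be an $\mathbb F_q$-linear subspace of dimension $k$. Let $\mathcal C$ be a $\mathrm{PCLP}(R,\ell)$ code, i.e. $\mathcal C=\varphi(f(V))\le\mathbb F_q^n$ where $f(X)=\sum_{i=0}^{\ell-1}f_iX^{q^i}$ and $f_0,\dots,f_{\ell-1}$ are sampled independently and uniformly at random from $\mathbb F_{q^n}$. Fix $\varepsilon>0$. Then (with $o(1)$ denoting a quantity tending to $0$ as $n\to\infty$ with $q,\ell$ fixed): (1) If $\mathcal P$ is an $\ell$-local property (of block-length $n$ codes over $\mathbb F_q$) with $R\le R_{\mathrm{RLC}}(\mathcal P)-\varepsilon$, then $\mathcal C$ satisfies $\mathcal P$ with probability at least $1-q^{-n(\varepsilon-o(1))}$. (2) If $\varepsilon\le R$, then with probability at least $1-q^{-n(\varepsilon-o(1))}$ the (relative) minimum distance of the dual code $\mathcal C^\perp$ is at least $h_q^{-1}(R-\varepsilon)$. (3) With probability at least $1-q^{-(1-R)n}$, the code $\mathcal C$ has rate $R$ (i.e. $\dim_{\mathbb F_q}\mathcal C=k$). In particular, for $\mathcal P$ as in (1) and $\varepsilon\le R$, with probability at least $1-q^{-n(\varepsilon-o(1))}$ all of the following hold: $\mathcal C$ satisfies $\mathcal P$, $\mathcal C^\perp$ has minimum distance at least $h_q^{-1}(R-\varepsilon)$, and $\mathcal C$ has rate $R$.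
   Context: Codes are linear: $\mathcal C\le\mathbb F_q^n$ is an $\mathbb F_q$-subspace, with block-length $n$ and rate $\dim(\mathcal C)/n$. The relative Hamming distance is $d(x,y)=\frac1n|\{i:x_i\ne y_i\}|$; the minimum distance of a linear code is the minimum relative Hamming weight of a nonzero codeword. The dual code is $\mathcal C^\perp=\{y\in\mathbb F_q^n:\langle x,y\rangle=\sum_i x_iy_i=0\ \forall x\in\mathcal C\}$. The $q$-ary entropy function is $h_q(x)=x\log_q(q-1)+x\log_q\frac1x+(1-x)\log_q\frac1{1-x}$ (extended by continuity, $h_q(0)=0$); it increases from $0$ to $1$ on $[0,1-1/q]$ and $h_q^{-1}:[0,1]\to[0,1-1/q]$ is the inverse of this restriction. PCLP codes: fix a basis $\alpha_1,\dots,\alpha_k$ of $V$ over $\mathbb F_q$, extend it to a basis $\alpha_1,\dots,\alpha_n$ of $\mathbb F_{q^n}$ over $\mathbb F_q$, and let $\varphi:\mathbb F_{q^n}\to\mathbb F_q^n$ be the $\mathbb F_q$-linear isomorphism $\sum_i x_i\alpha_i\mapsto(x_1,\dots,x_n)$. For $f(X)=\sum_{i=0}^{\ell-1}f_iX^{q^i}$ with $f_i$ independent and uniform in $\mathbb F_{q^n}$ (such $f$ acts $\mathbb F_q$-linearly on $\mathbb F_{q^n}$), the code $\mathcal C=\{\varphi(f(\alpha)):\alpha\in V\}$ is called a $\mathrm{PCLP}(R,\ell)$ code, $R=k/n$. Random linear codes: for $R=k/n$, $\mathrm{RLC}(R)$ is the random code $\{x\in\mathbb F_q^n:Hx^\top=0\}$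 with $H\in\mathbb F_q^{(n-k)\times n}$ uniformly random. Local properties: for $A\in\mathbb F_q^{n\times\ell}$ let $\mathrm{Emp}_A$ be the distribution on $\mathbb F_q^\ell$ of a uniformly random row of $A$; for a distribution $\tau$ on $\mathbb F_q^\ell$ let $\mathcal M_{n,\tau}=\{A\in\mathbb F_q^{n\times\ell}:\mathrm{Emp}_A=\tau\}$. Write $A\subseteq\mathcal C$ if every column of $A$ lies in $\mathcal C$. A property $\mathcal P$ (a family of linear codes $\mathcal C\le\mathbb F_q^n$) is $\ell$-local if there is a finite set $T$ of distributions on $\mathbb F_q^\ell$ such that $\mathcal C\in\mathcal P$ iff for all $\tau\in T$ and all $A\in\mathcal M_{n,\tau}$, $A\not\subseteq\mathcal C$. Its threshold rate is $R_{\mathrm{RLC}}(\mathcal P)=\sup\{R\in[0,1]:\Pr[\mathrm{RLC}(R)\text{ satisfies }\mathcal P]\ge1/2\}$ (over those $R$ for which $Rn$ is an integer). *)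

theory Defs
  imports
    "HOL-Probability.Probability"
    "HOL-Algebra.Algebraic_Closure_Type"
    "Jordan_Normal_Form.Matrix_Kernel"
begin

section \<open>Linear codes\<close>

text \<open>
  The field \<open>F\<^sub>q\<close> is a type \<^typ>\<open>'a::finite_field\<close>, with \<open>q = CARD('a)\<close>, and \<open>F\<^sub>q\<^sup>n\<close> is
  \<^term>\<open>carrier_vec n :: 'a::finite_field vec set\<close>.
\<close>

definition linear_code :: "nat \<Rightarrow> 'a::finite_field vec set \<Rightarrow> bool" where
  "linear_code n C \<longleftrightarrow> VectorSpace.subspace class_ring C (module_vec TYPE('a) n)"

definition code_dim :: "nat \<Rightarrow> 'a::finite_field vec set \<Rightarrow> nat" where
  "code_dim n C = vectorspace.dim class_ring ((module_vec TYPE('a) n)\<lparr>carrier := C\<rparr>)"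

definition code_rate :: "nat \<Rightarrow> 'a::finite_field vec set \<Rightarrow> real" where
  "code_rate n C = real (code_dim n C) / real n"

definition rel_hamming_dist :: "nat \<Rightarrow> 'a vec \<Rightarrow> 'a vec \<Rightarrow> real" where
  "rel_hamming_dist n x y = real (card {i. i < n \<and> x $ i \<noteq> y $ i}) / real n"

text \<open>
  The value is extended real so that the code \<open>{0}\<close>, which has no nonzero codeword, gets
  minimum distance \<^term>\<open>\<infinity> :: ereal\<close>, the infimum of the empty set.
\<close>

definition min_distance :: "nat \<Rightarrow> 'a::finite_field vec set \<Rightarrow> ereal" where
  "min_distance n C = (INF x \<in> C - {0\<^sub>v n}. ereal (rel_hamming_dist n x (0\<^sub>v n)))"

definition dual_code :: "nat \<Rightarrow> 'a::finite_field vec set \<Rightarrow> 'a vec set" where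
  "dual_code n C = {y \<in> carrier_vec n. \<forall>x\<in>C. x \<bullet> y = 0}"


section \<open>The \<open>q\<close>-ary entropy function\<close>

text \<open>
  Since \<^prop>\<open>log b 0 = (0 :: real)\<close> and \<^prop>\<open>1 / 0 = (0 :: real)\<close>, the formula takes the values of
  its continuous extension at \<^term>\<open>0 :: real\<close> and \<^term>\<open>1 :: real\<close>.
\<close>

definition qary_entropy :: "nat \<Rightarrow> real \<Rightarrow> real" where
  "qary_entropy q x =
     x * log q (real q - 1) + x * log q (1 / x) + (1 - x) * log q (1 / (1 - x))"

definition qary_entropy_inv :: "nat \<Rightarrow> real \<Rightarrow> real" where
  "qary_entropy_inv q = the_inv_into {0..1 - 1 / real q} (qary_entropy q)"


section \<open>Random linear codes and local properties\<close>

definition RLC :: "nat \<Rightarrow> nat \<Rightarrow> 'a::finite_field vec set pmf" where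
  "RLC n k = map_pmf mat_kernel (pmf_of_set (carrier_mat (n - k) n))"

definition row_distribution :: "'a mat \<Rightarrow> 'a vec pmf" where
  "row_distribution A = map_pmf (row A) (pmf_of_set {..<dim_row A})"

definition matrices_of_type :: "nat \<Rightarrow> nat \<Rightarrow> 'a vec pmf \<Rightarrow> 'a mat set" where
  "matrices_of_type n l \<tau> = {A \<in> carrier_mat n l. row_distribution A = \<tau>}"

definition columns_in :: "'a mat \<Rightarrow> 'a vec set \<Rightarrow> bool" where
  "columns_in A C \<longleftrightarrow> (\<forall>j<dim_col A. col A j \<in> C)"

definition local_property :: "nat \<Rightarrow> nat \<Rightarrow> 'a::finite_field vec set set \<Rightarrow> bool" where
  "local_property n l P \<longleftrightarrow>
     P \<subseteq> {C. linear_code n C} \<and>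
     (\<exists>T :: 'a vec pmf set. finite T \<and> (\<forall>\<tau>\<in>T. set_pmf \<tau> \<subseteq> carrier_vec l) \<and>
        (\<forall>C. linear_code n C \<longrightarrow>
           (C \<in> P \<longleftrightarrow> (\<forall>\<tau>\<in>T. \<forall>A\<in>matrices_of_type n l \<tau>. \<not> columns_in A C))))"

text \<open>
  The supremum is taken in \<open>[0, 1]\<close>, so it is \<open>0\<close> if no rate qualifies; inserting \<open>0\<close> achieves
  this and changes nothing otherwise.
\<close>

definition threshold_rate :: "nat \<Rightarrow> 'a::finite_field vec set set \<Rightarrow> real" where
  "threshold_rate n P =
     Sup (insert 0 {real k / real n | k. k \<le> n \<and> measure_pmf.prob (RLC n k) P \<ge> 1 / 2})"


section \<open>PCLP codes\<close>

text \<open>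
  The field with \<open>q\<^sup>n\<close> elements is realised as the unique subfield of that order of the algebraic
  closure of \<open>F\<^sub>q\<close>.
\<close>

definition ext_field :: "nat \<Rightarrow> 'a::finite_field alg_closure set" where
  "ext_field n = {x. x ^ (CARD('a) ^ n) = x}"

definition ac_scale :: "'a::field \<Rightarrow> 'a alg_closure \<Rightarrow> 'a alg_closure" where
  "ac_scale c x = to_ac c * x"

interpretation ac: vector_space "ac_scale :: 'a::field \<Rightarrow> 'a alg_closure \<Rightarrow> 'a alg_closure"
  by unfold_locales (auto simp: ac_scale_def algebra_simps)

text \<open>
  The basis is \<open>\<alpha> 0, \<dots>, \<alpha> (n - 1)\<close>, and its first \<open>k\<close> members are a basis of \<open>V\<close>.
\<close>

definition adapted_basis ::
    "nat \<Rightarrow> nat \<Rightarrow> 'a::finite_field alg_closure set \<Rightarrow> (nat \<Rightarrow> 'a alg_closure) \<Rightarrow> bool" where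
  "adapted_basis n k V \<alpha> \<longleftrightarrow>
     inj_on \<alpha> {..<n} \<and> ac.independent (\<alpha> ` {..<n}) \<and>
     ac.span (\<alpha> ` {..<n}) = ext_field n \<and> ac.span (\<alpha> ` {..<k}) = V"

definition coord_map ::
    "nat \<Rightarrow> (nat \<Rightarrow> 'a::finite_field alg_closure) \<Rightarrow> 'a alg_closure \<Rightarrow> 'a vec" where
  "coord_map n \<alpha> x = vec n (\<lambda>i. ac.representation (\<alpha> ` {..<n}) x (\<alpha> i))"

definition linearized_eval ::
    "nat \<Rightarrow> (nat \<Rightarrow> 'a::finite_field alg_closure) \<Rightarrow> 'a alg_closure \<Rightarrow> 'a alg_closure" where
  "linearized_eval l f x = (\<Sum>i<l. f i * x ^ (CARD('a) ^ i))"

definition PCLP ::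
    "nat \<Rightarrow> nat \<Rightarrow> 'a::finite_field alg_closure set \<Rightarrow> (nat \<Rightarrow> 'a alg_closure) \<Rightarrow> 'a vec set pmf" where
  "PCLP n l V \<alpha> =
     map_pmf (\<lambda>f. (\<lambda>x. coord_map n \<alpha> (linearized_eval l f x)) ` V)
       (Pi_pmf {..<l} 0 (\<lambda>_. pmf_of_set (ext_field n)))"

end

theory Submission
  imports Defs "HOL-Real_Asymp.Real_Asymp"
begin

text \<open>
  A linearized polynomial of \<open>q\<close>-degree less than \<open>l\<close> takes independent uniform values on at most
  \<open>l\<close> linearly independent points, so a PCLP code contains a fixed subspace \<open>W\<close> of dimension at
  most \<open>l\<close> with probability at most \<open>\<bar>W\<bar>\<close> to the power \<open>-(n - k)\<close>, which is the probability for a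
  random linear code. Hence (1) reduces to a statement about random linear codes of a rate \<open>k'/n\<close>
  at which \<open>P\<close> holds with probability at least \<open>1/2\<close>: for every forbidden type \<open>\<tau>\<close> there must be a
  subspace \<open>D\<close> of \<open>F\<^sub>q\<^sup>l\<close> for which the restrictions of the matrices of type \<open>\<tau>\<close> to \<open>D\<close>
  number at most a constant times \<open>\<bar>AD\<bar>\<close> to the power \<open>n - k'\<close>. Otherwise the second moment method
  would produce a matrix of type \<open>\<tau>\<close> in the code with probability at least \<open>3/4\<close>. A first moment
  bound over these restrictions, and over the polynomially many types, gives (1).

  For (2), the multiplier \<open>f 0\<close> alone makes a nonzero \<open>y\<close> lie in the dual code with probability
  \<open>q\<close> to the power \<open>-k\<close>, and the Hamming ball of relative radius \<open>d\<close> has at most \<open>q\<close> to the power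
  \<open>n h(d)\<close> elements. For (3), \<open>f\<close> vanishes at a given nonzero point of \<open>V\<close> with probability \<open>q\<close> to
  the power \<open>-n\<close>.
\<close>

no_notation fps_nth (infixl \<open>$\<close> 75)

section \<open>Linearized polynomials over the algebraic closure\<close>

lemma card_field_gt_1: "1 < CARD('a::finite_field)"
proof -
  have "card {0, 1::'a} \<le> CARD('a)"
    by (intro card_mono) auto
  thus ?thesis by simp
qed

lemma card_field_pos: "0 < CARD('a::finite_field)"
  using card_field_gt_1[where ?'a = 'a] by linarith

text \<open>Since x^q = x on F_q, the polynomial (X+1)^q - X^q - 1 vanishes at all q elements of the
  field, while its degree is below q; hence it is the zero polynomial. This yields additivity of the
  q-power map without going through the characteristic.\<close>

lemma finite_field_of_nat_binomial_eq_0: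
  assumes "0 < i" "i < CARD('a::finite_field)"
  shows "(of_nat (CARD('a) choose i) :: 'a) = 0"
proof -
  let ?q = "CARD('a)"
  define P :: "'a poly" where "P = (\<Sum>i\<in>{0<..<?q}. Polynomial.monom (of_nat (?q choose i)) i)"
  have coeff: "Polynomial.coeff P j = (if j \<in> {0<..<?q} then of_nat (?q choose j) else 0)" for j
    unfolding P_def by (auto simp: coeff_sum)
  have roots: "poly P x = 0" for x
  proof -
    have "(x + 1) ^ ?q = (\<Sum>k\<le>?q. of_nat (?q choose k) * x ^ k * 1 ^ (?q - k))"
      by (rule binomial_ring)
    also have "\<dots> = (\<Sum>k\<in>{0<..<?q} \<union> {0, ?q}. of_nat (?q choose k) * x ^ k)"
      by (intro sum.cong) (use card_field_gt_1[where ?'a = 'a] in auto)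
    also have "\<dots> = (\<Sum>k\<in>{0<..<?q}. of_nat (?q choose k) * x ^ k) + (1 + x ^ ?q)"
      by (subst sum.union_disjoint) (use card_field_gt_1[where ?'a = 'a] in auto)
    finally have "(\<Sum>k\<in>{0<..<?q}. of_nat (?q choose k) * x ^ k) = 0"
      unfolding finite_field_power_card_eq_same by simp
    thus ?thesis unfolding P_def by (simp add: poly_sum poly_monom)
  qed
  have "P = 0"
  proof (rule ccontr)
    assume "P \<noteq> 0"
    have "Polynomial.degree P \<le> ?q - 1"
      by (rule degree_le) (auto simp: coeff)
    moreover have "{x. poly P x = 0} = UNIV" using roots by auto
    ultimately show False
      using card_poly_roots_bound[OF \<open>P \<noteq> 0\<close>] card_field_gt_1[where ?'a = 'a] by simp
  qed
  thus ?thesis using coeff[of i] assms by simp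
qed

lemma ac_power_card_add:
  fixes x y :: "'a::finite_field alg_closure"
  shows "(x + y) ^ CARD('a) = x ^ CARD('a) + y ^ CARD('a)"
proof -
  let ?q = "CARD('a)"
  have zero: "(of_nat (?q choose k) :: 'a alg_closure) = 0" if "k \<in> {0<..<?q}" for k
    using finite_field_of_nat_binomial_eq_0[of k, where ?'a = 'a] that
    by (metis greaterThanLessThan_iff to_ac_0 to_ac_of_nat)
  have "(x + y) ^ ?q = (\<Sum>k\<le>?q. of_nat (?q choose k) * x ^ k * y ^ (?q - k))"
    by (rule binomial_ring)
  also have "\<dots> = (\<Sum>k\<in>{0, ?q}. of_nat (?q choose k) * x ^ k * y ^ (?q - k))"
    by (intro sum.mono_neutral_right) (auto intro!: zero)
  finally show ?thesis using card_field_gt_1[where ?'a = 'a] by (simp add: add_ac)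
qed

lemma ac_power_card_power_add:
  fixes x y :: "'a::finite_field alg_closure"
  shows "(x + y) ^ (CARD('a) ^ i) = x ^ (CARD('a) ^ i) + y ^ (CARD('a) ^ i)"
proof (induction i)
  case (Suc i)
  have "(x + y) ^ (CARD('a) ^ Suc i) = ((x + y) ^ (CARD('a) ^ i)) ^ CARD('a)"
    by (simp add: mult.commute flip: power_mult)
  also have "\<dots> = (x ^ (CARD('a) ^ i)) ^ CARD('a) + (y ^ (CARD('a) ^ i)) ^ CARD('a)"
    by (simp add: Suc ac_power_card_add)
  finally show ?case by (simp add: mult.commute flip: power_mult)
qed auto

lemma linearized_eval_add:
  "linearized_eval l f (x + y) = linearized_eval l f x + linearized_eval l f y"
  unfolding linearized_eval_def ac_power_card_power_add by (simp add: algebra_simps sum.distrib)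

lemma linearized_eval_scale:
  "linearized_eval l f (ac_scale (c :: 'a::finite_field) x) = ac_scale c (linearized_eval l f x)"
proof -
  have "to_ac c ^ (CARD('a) ^ i) = to_ac c" for i
    by (metis to_ac_power finite_field_power_card_power_eq_same)
  thus ?thesis unfolding linearized_eval_def ac_scale_def
    by (simp add: power_mult_distrib sum_distrib_left mult.left_commute)
qed

lemma linearized_eval_zero [simp]: "linearized_eval l f (0 :: 'a::finite_field alg_closure) = 0"
  unfolding linearized_eval_def by (simp add: power_0_left)

lemma linearized_eval_sum:
  "linearized_eval l f (\<Sum>x\<in>A. ac_scale (c x) (g x)) = (\<Sum>x\<in>A. ac_scale (c x) (linearized_eval l f (g x)))"
  by (induction A rule: infinite_finite_induct)
    (auto simp: linearized_eval_add linearized_eval_scale)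

lemma ac_card_span:
  fixes B :: "'a::finite_field alg_closure set"
  assumes "finite B" "ac.independent B"
  shows "finite (ac.span B)" "card (ac.span B) = CARD('a) ^ card B"
proof -
  let ?F = "\<lambda>u. \<Sum>v\<in>B. ac_scale (u v) v"
  have bij: "bij_betw ?F (B \<rightarrow>\<^sub>E UNIV) (ac.span B)"
  proof (rule bij_betwI')
    fix u v :: "'a alg_closure \<Rightarrow> 'a" assume uv: "u \<in> B \<rightarrow>\<^sub>E UNIV" "v \<in> B \<rightarrow>\<^sub>E UNIV"
    show "(?F u = ?F v) = (u = v)"
    proof
      assume "?F u = ?F v"
      hence "(\<Sum>x\<in>B. ac_scale (u x - v x) x) = 0"
        by (simp add: ac.scale_left_diff_distrib sum_subtractf)
      hence "u x - v x = 0" if "x \<in> B" for x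
        using ac.independentD[OF assms(2,1) order.refl, of "\<lambda>x. u x - v x" x] that by blast
      thus "u = v" using uv by (intro PiE_ext[of u B "\<lambda>_. UNIV"]) auto
    qed simp
  next
    fix u show "?F u \<in> ac.span B" by (intro ac.span_sum ac.span_scale ac.span_base)
  next
    fix y assume "y \<in> ac.span B"
    then obtain u where "y = ?F u" unfolding ac.span_finite[OF assms(1)] by auto
    hence "y = ?F (restrict u B)" by simp
    thus "\<exists>x\<in>B \<rightarrow>\<^sub>E UNIV. y = ?F x" by (intro bexI[of _ "restrict u B"]) auto
  qed
  have fin: "finite (B \<rightarrow>\<^sub>E (UNIV :: 'a set))"
    using assms(1) by (intro finite_PiE) auto
  have card: "card (B \<rightarrow>\<^sub>E (UNIV :: 'a set)) = CARD('a) ^ card B"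
    using assms(1) by (simp add: card_PiE)
  show "finite (ac.span B)" using fin bij_betw_finite[OF bij] by blast
  show "card (ac.span B) = CARD('a) ^ card B" using card bij_betw_same_card[OF bij] by simp
qed

text \<open>With e = \<open>card B\<close>, the upper l - e coefficients determine the others: the
  difference of two interpolants with the same upper coefficients has degree at most q^(e-1), yet by
  linearity it vanishes on all q^e points of the span of \<open>B\<close>.\<close>

lemma card_linearized_interpolants_le:
  fixes B :: "'a::finite_field alg_closure set"
  assumes B: "finite B" "ac.independent B" "card B \<le> l" and E: "finite E"
  shows "card {f \<in> PiE_dflt {..<l} 0 (\<lambda>_. E). \<forall>b\<in>B. linearized_eval l f b = w b} \<le> card E ^ (l - card B)"
proof -
  let ?e = "card B" and ?q = "CARD('a)"
  let ?S = "{f \<in> PiE_dflt {..<l} 0 (\<lambda>_. E). \<forall>b\<in>B. linearized_eval l f b = w b}"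
  have inj: "inj_on (\<lambda>f. restrict f {?e..<l}) ?S"
  proof (rule inj_onI)
    fix f g assume f: "f \<in> ?S" and g: "g \<in> ?S" and eq: "restrict f {?e..<l} = restrict g {?e..<l}"
    have eq': "f i = g i" if "?e \<le> i" for i
    proof (cases "i < l")
      case True
      thus ?thesis using fun_cong[OF eq, of i] that by simp
    next
      case False
      thus ?thesis using f g by (auto simp: PiE_dflt_def)
    qed
    define P :: "'a alg_closure poly" where "P = (\<Sum>i<?e. Polynomial.monom (f i - g i) (?q ^ i))"
    define h where "h = (\<lambda>i. f i - g i)"
    have poly: "poly P x = linearized_eval l h x" for x
    proof -
      have "linearized_eval l h x = (\<Sum>i<?e. h i * x ^ (?q ^ i))"
        unfolding linearized_eval_def
        by (intro sum.mono_neutral_right) (use B eq' in \<open>auto simp: h_def\<close>)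
      thus ?thesis by (simp add: P_def poly_sum poly_monom h_def)
    qed
    have h0: "linearized_eval l h b = 0" if "b \<in> B" for b
      using f g that by (simp add: linearized_eval_def h_def left_diff_distrib sum_subtractf)
    have roots: "ac.span B \<subseteq> {x. poly P x = 0}"
      unfolding ac.span_finite[OF B(1)] using h0
      by (auto simp: poly linearized_eval_sum)
    have "P = 0"
    proof (rule ccontr)
      assume P: "P \<noteq> 0"
      have "?e \<noteq> 0" using P unfolding P_def by (metis lessThan_0 sum.empty)
      have "Polynomial.degree P \<le> ?q ^ (?e - 1)" unfolding P_def
        by (intro degree_sum_le)
          (auto intro!: order.trans[OF degree_monom_le] power_increasing simp: Suc_leI)
      also have "\<dots> < ?q ^ ?e" using \<open>?e \<noteq> 0\<close> card_field_gt_1[where ?'a = 'a]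
        by (intro power_strict_increasing) auto
      also have "\<dots> = card (ac.span B)" using ac_card_span(2)[OF B(1,2)] by simp
      also have "\<dots> \<le> card {x. poly P x = 0}"
        by (intro card_mono roots poly_roots_finite P)
      also have "\<dots> \<le> Polynomial.degree P" by (rule card_poly_roots_bound[OF P])
      finally show False by simp
    qed
    have "f i = g i" if "i < ?e" for i
    proof -
      \<comment> \<open>The exponents q^j are pairwise distinct because q > 1, so each coefficient
        difference can be read off separately.\<close>
      have "Polynomial.coeff P (?q ^ i) = (\<Sum>j<?e. if j = i then f j - g j else 0)"
        unfolding P_def coeff_sum using card_field_gt_1[where ?'a = 'a]
        by (intro sum.cong) auto
      thus ?thesis using that \<open>P = 0\<close> by simp
    qed
    thus "f = g" using eq' by (intro ext) (metis not_less)
  qed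
  have "card ?S \<le> card ({?e..<l} \<rightarrow>\<^sub>E E)"
    by (rule card_inj_on_le[OF inj]) (auto simp: PiE_dflt_def E intro!: finite_PiE)
  also have "\<dots> = card E ^ (l - ?e)" by (simp add: card_PiE)
  finally show ?thesis .
qed

section \<open>Duality and counting for linear codes\<close>

lemma card_fibres_eq:
  assumes "finite S" "finite T" "f ` S \<subseteq> T" "\<And>y. y \<in> T \<Longrightarrow> card {x \<in> S. f x = y} = c"
  shows "card S = c * card T"
proof -
  have "card S = (\<Sum>x\<in>S. 1)" by simp
  also have "\<dots> = (\<Sum>y\<in>T. \<Sum>x | x \<in> S \<and> f x = y. 1)"
    by (rule sum.group[symmetric]) (use assms in auto)
  also have "\<dots> = c * card T" using assms(4) by simp
  finally show ?thesis .
qed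

text \<open>The translations \<open>t c\<close> match the fibre over 0 with the fibre over c, so all
  q fibres of \<open>lam\<close> have the same size. The set stays abstract because the lemma serves
  vectors, codewords, points of \<open>V\<close> and coefficient families.\<close>

lemma card_zeros_of_translatable:
  fixes lam :: "'s \<Rightarrow> 'a::finite_field" and t :: "'a \<Rightarrow> 's \<Rightarrow> 's"
  assumes "finite S" and t: "\<And>c s. s \<in> S \<Longrightarrow> t c s \<in> S" "\<And>c s. s \<in> S \<Longrightarrow> lam (t c s) = lam s + c"
    "\<And>c s. s \<in> S \<Longrightarrow> t (- c) (t c s) = s"
  shows "CARD('a) * card {s \<in> S. lam s = 0} = card S"
proof -
  have "card {s \<in> S. lam s = c} = card {s \<in> S. lam s = 0}" for c
    by (rule bij_betw_same_card[of "t (- c)"], rule bij_betw_byWitness[where f' = "t c"])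
      (use t t(3)[of _ "- c"] in auto)
  from card_fibres_eq[where f = lam and T = UNIV and S = S, OF _ _ _ this] assms(1)
  show ?thesis by simp
qed

text \<open>The proof counts the pairs \<open>(s, u)\<close> with \<open>\<beta> s u = 0\<close> in both orders.\<close>

lemma card_annihilator:
  fixes \<beta> :: "'s \<Rightarrow> 'u \<Rightarrow> 'a::finite_field"
  assumes fin: "finite S" "finite U" and z: "z \<in> U" "\<And>s. \<beta> s z = 0"
    and zeros_left: "\<And>u. u \<in> U \<Longrightarrow> u \<noteq> z \<Longrightarrow> CARD('a) * card {s \<in> S. \<beta> s u = 0} = card S"
    and zeros_right: "\<And>s. s \<in> S \<Longrightarrow> \<exists>u\<in>U. \<beta> s u \<noteq> 0 \<Longrightarrow> CARD('a) * card {u \<in> U. \<beta> s u = 0} = card U"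
  shows "card {s \<in> S. \<forall>u\<in>U. \<beta> s u = 0} * card U = card S"
proof -
  let ?q = "int CARD('a)" and ?N = "{s \<in> S. \<forall>u\<in>U. \<beta> s u = 0}"
  have cardU: "int (card (U - {z})) = int (card U) - 1"
    using z(1) fin(2) by (metis card_Suc_Diff1 add_diff_cancel_left' of_nat_Suc)
  have cardN: "int (card (S - ?N)) = int (card S) - int (card ?N)"
    using fin(1) by (subst card_Diff_subset) (auto simp: of_nat_diff card_mono)
  have "(\<Sum>u\<in>U. ?q * int (card {s \<in> S. \<beta> s u = 0})) = (\<Sum>s\<in>S. ?q * int (card {u \<in> U. \<beta> s u = 0}))"
  proof -
    have "(\<Sum>u\<in>U. card {s \<in> S. \<beta> s u = 0}) = (\<Sum>s\<in>S. card {u \<in> U. \<beta> s u = 0})"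
      using fin by (intro sum_multicount_gen) auto
    hence "(\<Sum>u\<in>U. int (card {s \<in> S. \<beta> s u = 0})) = (\<Sum>s\<in>S. int (card {u \<in> U. \<beta> s u = 0}))"
      by (simp flip: of_nat_sum)
    thus ?thesis by (simp flip: sum_distrib_left)
  qed
  \<comment> \<open>The element \<open>z\<close> pairs to zero with everything and contributes q
    |S|; every other \<open>u\<close> contributes |S|.\<close>
  moreover have "(\<Sum>u\<in>U. ?q * int (card {s \<in> S. \<beta> s u = 0})) = ?q * int (card S) + (int (card U) - 1) * int (card S)"
  proof -
    have "(\<Sum>u\<in>U - {z}. ?q * int (card {s \<in> S. \<beta> s u = 0})) = (\<Sum>u\<in>U - {z}. int (card S))"
      by (intro sum.cong refl) (metis zeros_left Diff_iff insertI1 of_nat_mult)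
    thus ?thesis using fin z cardU by (subst sum.remove[of _ z]) auto
  qed
  moreover have "(\<Sum>s\<in>S. ?q * int (card {u \<in> U. \<beta> s u = 0}))
     = ?q * int (card ?N) * int (card U) + (int (card S) - int (card ?N)) * int (card U)"
  proof -
    have "(\<Sum>s\<in>S - ?N. ?q * int (card {u \<in> U. \<beta> s u = 0})) = (\<Sum>s\<in>S - ?N. int (card U))"
      by (intro sum.cong refl) (auto simp: zeros_right simp flip: of_nat_mult)
    moreover have "(\<Sum>s\<in>?N. ?q * int (card {u \<in> U. \<beta> s u = 0})) = (\<Sum>s\<in>?N. ?q * int (card U))"
      by (intro sum.cong refl arg_cong[where f = "\<lambda>x. ?q * int (card x)"]) auto
    moreover have "(\<Sum>s\<in>S. ?q * int (card {u \<in> U. \<beta> s u = 0})) =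
      (\<Sum>s\<in>S - ?N. ?q * int (card {u \<in> U. \<beta> s u = 0})) + (\<Sum>s\<in>?N. ?q * int (card {u \<in> U. \<beta> s u = 0}))"
      using fin by (intro sum.subset_diff) auto
    ultimately show ?thesis by (simp add: cardN mult_ac)
  qed
  \<comment> \<open>In the equation of the two counts the term |S| |U| cancels, and both sides are
    left with the factor q - 1.\<close>
  ultimately have "(?q - 1) * (int (card ?N) * int (card U)) = (?q - 1) * int (card S)"
    by (simp add: algebra_simps)
  moreover have "1 < CARD('a)" by (rule card_field_gt_1)
  ultimately have "int (card ?N * card U) = int (card S)" by simp
  thus ?thesis by linarith
qed

section \<open>Counting vectors and matrices\<close>

lemma bij_betw_carrier_vec: "bij_betw (\<lambda>f. vec n f) ({..<n} \<rightarrow>\<^sub>E (UNIV :: 'a set)) (carrier_vec n)"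
  by (rule bij_betw_byWitness[where f' = "\<lambda>v :: 'a vec. restrict (\<lambda>i. v $ i) {..<n}"])
    (auto simp: PiE_def extensional_def fun_eq_iff)

lemma finite_carrier_vec [simp]: "finite (carrier_vec n :: 'a::finite vec set)"
  using bij_betw_finite[OF bij_betw_carrier_vec[of n, where ?'a = 'a]] finite_PiE[of "{..<n}" "\<lambda>_. UNIV :: 'a set"]
  by auto

lemma card_carrier_vec: "card (carrier_vec n :: 'a::finite vec set) = CARD('a) ^ n"
  using bij_betw_same_card[OF bij_betw_carrier_vec[of n, where ?'a = 'a]] by (simp add: card_PiE)

lemma bij_betw_mat_rows:
  assumes "S \<subseteq> carrier_vec n"
  shows "bij_betw (\<lambda>A. restrict (row A) {..<m}) {A \<in> carrier_mat m n. \<forall>i<m. row A i \<in> S} ({..<m} \<rightarrow>\<^sub>E S)"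
proof (rule bij_betw_byWitness[where f' = "\<lambda>f. mat_of_row_fun m n f"], goal_cases)
  case 1
  show ?case by auto
next
  case 2
  have "row (mat_of_row_fun m n f) i = f i" if "f \<in> {..<m} \<rightarrow>\<^sub>E S" "i < m" for f i
    using that assms by (intro row_mat_of_row_fun) (auto simp: PiE_iff subset_iff)
  thus ?case by (auto simp: fun_eq_iff PiE_def extensional_def)
next
  case 3
  show ?case by auto
next
  case 4
  have "row (mat_of_row_fun m n f) i = f i" if "f \<in> {..<m} \<rightarrow>\<^sub>E S" "i < m" for f i
    using that assms by (intro row_mat_of_row_fun) (auto simp: PiE_iff subset_iff)
  thus ?case by (auto simp: PiE_iff intro!: mat_row_carrierI)
qed

lemma card_mat_rows:
  assumes "S \<subseteq> carrier_vec n"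
  shows "card {A \<in> carrier_mat m n. \<forall>i<m. row A i \<in> S} = card S ^ m"
  using bij_betw_same_card[OF bij_betw_mat_rows[OF assms, of m]] by (simp add: card_PiE)

lemma finite_carrier_mat [simp]: "finite (carrier_mat m n :: 'a::finite mat set)"
proof -
  have "{A \<in> carrier_mat m n. \<forall>i<m. row A i \<in> carrier_vec n} = (carrier_mat m n :: 'a mat set)"
    by auto
  thus ?thesis using bij_betw_finite[OF bij_betw_mat_rows[of "carrier_vec n :: 'a vec set" n m]]
    by (simp add: finite_PiE)
qed

lemma card_carrier_mat: "card (carrier_mat m n :: 'a::finite mat set) = CARD('a) ^ (n * m)"
proof -
  have "{A \<in> carrier_mat m n. \<forall>i<m. row A i \<in> carrier_vec n} = (carrier_mat m n :: 'a mat set)"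
    by auto
  thus ?thesis using card_mat_rows[of "carrier_vec n :: 'a vec set" n m]
    by (simp add: card_carrier_vec power_mult)
qed

section \<open>Annihilators, kernels and column spaces\<close>

lemma linear_code_iff:
  "linear_code n C \<longleftrightarrow> C \<subseteq> carrier_vec n \<and> 0\<^sub>v n \<in> C \<and>
     (\<forall>x\<in>C. \<forall>y\<in>C. x + y \<in> C) \<and> (\<forall>c. \<forall>x\<in>C. c \<cdot>\<^sub>v x \<in> C)"
proof -
  have vs: "vectorspace class_ring (module_vec TYPE('a) n)" by (rule vec_vs)
  have "module class_ring (module_vec TYPE('a) n)" by (rule vec_module)
  thus ?thesis
    unfolding linear_code_def subspace_def submodule_def using vs
    by (auto simp: module_vec_simps class_ring_simps)
qed

text \<open>The dot product pairs the whole space with \<open>U\<close>, and every nonzero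
  \<open>u\<close> has a vector whose product with it is 1, so \<open>card_annihilator\<close>
  applies. This is the dimension formula for the dual code, with cardinalities in place of
  dimensions.\<close>

lemma card_annihilator_code:
  fixes U :: "'a::finite_field vec set"
  assumes "linear_code n U"
  shows "card {h \<in> carrier_vec n. \<forall>u\<in>U. h \<bullet> u = 0} * card U = CARD('a) ^ n"
proof -
  note U = assms[unfolded linear_code_iff]
  have Uc: "u \<in> carrier_vec n" if "u \<in> U" for u using that U by auto
  have finU: "finite U" using U finite_carrier_vec finite_subset by blast
  have "card {h \<in> carrier_vec n. \<forall>u\<in>U. h \<bullet> u = 0} * card U = card (carrier_vec n :: 'a vec set)"
  proof (rule card_annihilator[where z = "0\<^sub>v n"])
    fix u assume u: "u \<in> U" "u \<noteq> 0\<^sub>v n"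
    then obtain i where i: "i < n" "u $ i \<noteq> 0" using Uc by (metis carrier_vecD eq_vecI index_zero_vec)
    define w where "w = (1 / (u $ i)) \<cdot>\<^sub>v unit_vec n i"
    have w: "w \<in> carrier_vec n" "w \<bullet> u = 1" using Uc[OF u(1)] i by (auto simp: w_def)
    show "CARD('a) * card {s \<in> carrier_vec n. s \<bullet> u = 0} = card (carrier_vec n :: 'a vec set)"
    proof (rule card_zeros_of_translatable[where t = "\<lambda>c s. s + c \<cdot>\<^sub>v w"])
      fix c :: 'a and s :: "'a vec" assume s: "s \<in> carrier_vec n"
      show "s + c \<cdot>\<^sub>v w \<in> carrier_vec n" using s w by auto
      show "(s + c \<cdot>\<^sub>v w) \<bullet> u = s \<bullet> u + c" using s w Uc[OF u(1)]
        by (simp add: add_scalar_prod_distrib[of _ n])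
      show "s + c \<cdot>\<^sub>v w + - c \<cdot>\<^sub>v w = s" using s w by (intro eq_vecI) auto
    qed simp
  next
    fix s :: "'a vec" assume s: "s \<in> carrier_vec n" "\<exists>u\<in>U. s \<bullet> u \<noteq> 0"
    then obtain u where u: "u \<in> U" "s \<bullet> u \<noteq> 0" by auto
    define w where "w = (1 / (s \<bullet> u)) \<cdot>\<^sub>v u"
    have w: "w \<in> U" "s \<bullet> w = 1" "w \<in> carrier_vec n" using Uc[OF u(1)] u U s by (auto simp: w_def)
    show "CARD('a) * card {u \<in> U. s \<bullet> u = 0} = card U"
    proof (rule card_zeros_of_translatable[where t = "\<lambda>c s. s + c \<cdot>\<^sub>v w"])
      fix c :: 'a and x :: "'a vec" assume x: "x \<in> U"
      show "x + c \<cdot>\<^sub>v w \<in> U" using x w U by auto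
      show "s \<bullet> (x + c \<cdot>\<^sub>v w) = s \<bullet> x + c" using s w Uc[OF x]
        by (simp add: scalar_prod_add_distrib[of _ n])
      show "x + c \<cdot>\<^sub>v w + - c \<cdot>\<^sub>v w = x" using Uc[OF x] w by (intro eq_vecI) auto
    qed (rule finU)
  qed (use U finU in \<open>auto simp: scalar_prod_def\<close>)
  thus ?thesis by (simp add: card_carrier_vec)
qed

text \<open>Each of the m rows of \<open>H\<close> must lie in the annihilator of \<open>U\<close>,
  independently of the other rows. As a probability, a random kernel contains \<open>U\<close> with
  chance |U|^(-m).\<close>

lemma card_kernel_contains:
  fixes U :: "'a::finite_field vec set"
  assumes "linear_code n U"
  shows "card {H \<in> carrier_mat m n. U \<subseteq> mat_kernel H} * card U ^ m = card (carrier_mat m n :: 'a mat set)"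
proof -
  have U: "U \<subseteq> carrier_vec n" using assms by (simp add: linear_code_iff)
  have "{H \<in> carrier_mat m n. U \<subseteq> mat_kernel H} =
    {H \<in> carrier_mat m n. \<forall>i<m. row H i \<in> {h \<in> carrier_vec n. \<forall>u\<in>U. h \<bullet> u = 0}}"
  proof (intro Collect_cong conj_cong refl)
    fix H :: "'a mat" assume H: "H \<in> carrier_mat m n"
    have "u \<in> mat_kernel H \<longleftrightarrow> (\<forall>i<m. row H i \<bullet> u = 0)" if "u \<in> U" for u
      using that U H unfolding mat_kernel[OF H] by (auto simp: vec_eq_iff)
    thus "U \<subseteq> mat_kernel H \<longleftrightarrow> (\<forall>i<m. row H i \<in> {h \<in> carrier_vec n. \<forall>u\<in>U. h \<bullet> u = 0})"
      using H by auto
  qed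
  hence "card {H \<in> carrier_mat m n. U \<subseteq> mat_kernel H} = card {h \<in> carrier_vec n. \<forall>u\<in>U. h \<bullet> u = 0} ^ m"
    using card_mat_rows[of "{h \<in> carrier_vec n. \<forall>u\<in>U. h \<bullet> u = 0}" n m] by simp
  thus ?thesis
    using card_annihilator_code[OF assms] by (simp add: card_carrier_mat power_mult flip: power_mult_distrib)
qed

lemma linear_code_mat_kernel:
  assumes "H \<in> carrier_mat m n"
  shows "linear_code n (mat_kernel H)"
  unfolding linear_code_iff mat_kernel[OF assms] using assms
  by (auto simp: mult_add_distrib_mat_vec[of _ m n] mult_mat_vec[of _ m n])

lemma linear_code_image_mat:
  assumes A: "A \<in> carrier_mat n l" and D: "linear_code l D"
  shows "linear_code n ((\<lambda>x. A *\<^sub>v x) ` D)"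
proof -
  note D' = D[unfolded linear_code_iff]
  show ?thesis unfolding linear_code_iff
  proof (intro conjI ballI allI)
    show "(\<lambda>x. A *\<^sub>v x) ` D \<subseteq> carrier_vec n"
      using A D' by (auto intro!: mult_mat_vec_carrier)
    have "A *\<^sub>v 0\<^sub>v l = 0\<^sub>v n" using A by auto
    thus "0\<^sub>v n \<in> (\<lambda>x. A *\<^sub>v x) ` D" using D' by (metis imageI)
    fix c x assume x: "x \<in> (\<lambda>x. A *\<^sub>v x) ` D"
    then obtain x' where x': "x' \<in> D" "x = A *\<^sub>v x'" by auto
    have "c \<cdot>\<^sub>v x = A *\<^sub>v (c \<cdot>\<^sub>v x')" using A D' x' by (auto simp: mult_mat_vec[of _ n l])
    thus "c \<cdot>\<^sub>v x \<in> (\<lambda>x. A *\<^sub>v x) ` D" using D' x' by blast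
    fix y assume "y \<in> (\<lambda>x. A *\<^sub>v x) ` D"
    then obtain y' where y': "y' \<in> D" "y = A *\<^sub>v y'" by auto
    have "x + y = A *\<^sub>v (x' + y')" using A D' x' y'
      by (simp add: mult_add_distrib_mat_vec[of _ n l] subset_iff)
    thus "x + y \<in> (\<lambda>x. A *\<^sub>v x) ` D" using D' x' y' by blast
  qed
qed

lemma columns_in_iff:
  assumes A: "A \<in> carrier_mat n l" and C: "linear_code n C"
  shows "columns_in A C \<longleftrightarrow> (\<lambda>x. A *\<^sub>v x) ` carrier_vec l \<subseteq> C"
proof
  assume "(\<lambda>x. A *\<^sub>v x) ` carrier_vec l \<subseteq> C"
  moreover have "col A j = A *\<^sub>v unit_vec l j" if "j < l" for j
    using that A by (intro eq_vecI) auto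
  ultimately show "columns_in A C" using A by (auto simp: columns_in_def image_subset_iff)
next
  assume cols: "columns_in A C"
  note C' = C[unfolded linear_code_iff]
  have "A *\<^sub>v x \<in> C" if x: "x \<in> carrier_vec l" for x
  proof -
    \<comment> \<open>\<open>y m\<close> is the part of \<open>A *\<^sub>v x\<close> contributed by
      the first m columns; the induction adds one column at a time.\<close>
    define y where "y m = vec n (\<lambda>i. \<Sum>j<m. A $$ (i, j) * x $ j)" for m
    have "y m \<in> C" if "m \<le> l" for m using that
    proof (induction m)
      case 0
      have "y 0 = 0\<^sub>v n" by (auto simp: y_def)
      thus ?case using C' by simp
    next
      case (Suc m)
      have "y (Suc m) = y m + (x $ m) \<cdot>\<^sub>v col A m" using Suc.prems A by (intro eq_vecI) (auto simp: y_def)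
      moreover have "col A m \<in> C" using cols Suc.prems A by (auto simp: columns_in_def)
      ultimately show ?case using Suc C' by simp
    qed
    moreover have "A *\<^sub>v x = y l" using A x
      by (intro eq_vecI) (auto simp: y_def scalar_prod_def atLeast0LessThan intro!: sum.cong)
    ultimately show ?thesis by simp
  qed
  thus "(\<lambda>x. A *\<^sub>v x) ` carrier_vec l \<subseteq> C" by auto
qed

section \<open>Matrices of a given type\<close>

lemma pmf_row_distribution:
  assumes "A \<in> carrier_mat n l" "n > 0"
  shows "pmf (row_distribution A) x = real (card {i. i < n \<and> row A i = x}) / real n"
proof -
  have "{..<n} \<inter> row A -` {x} = {i. i < n \<and> row A i = x}" by auto
  thus ?thesis using assms unfolding row_distribution_def pmf_map
    by (subst measure_pmf_of_set) (auto simp: lessThan_empty_iff)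
qed

text \<open>A type is determined by how often each of the q^l vectors occurs as a row, and each
  multiplicity is one of 0, ..., n. So a union bound over types costs only a polynomial factor,
  however many distributions define the property.\<close>

lemma card_row_distributions_le:
  assumes "n > 0"
  shows "finite (row_distribution ` (carrier_mat n l :: 'a::finite mat set))"
    "card (row_distribution ` (carrier_mat n l :: 'a::finite mat set)) \<le> (n + 1) ^ (CARD('a) ^ l)"
proof -
  show "finite (row_distribution ` (carrier_mat n l :: 'a mat set))" by simp
  define cnt :: "'a mat \<Rightarrow> 'a vec \<Rightarrow> nat" where
    "cnt A = restrict (\<lambda>x. card {i. i < n \<and> row A i = x}) (carrier_vec l)" for A
  have eq: "row_distribution A = row_distribution B"
    if "A \<in> carrier_mat n l" "B \<in> carrier_mat n l" "cnt A = cnt B" for A B :: "'a mat"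
  proof (rule pmf_eqI)
    fix x :: "'a vec"
    have "card {i. i < n \<and> row A i = x} = card {i. i < n \<and> row B i = x}"
    proof (cases "x \<in> carrier_vec l")
      case True
      thus ?thesis using fun_cong[OF that(3), of x] by (simp add: cnt_def)
    next
      case False
      hence "{i. i < n \<and> row A i = x} = {}" "{i. i < n \<and> row B i = x} = {}"
        using that by auto
      thus ?thesis by (simp only:)
    qed
    thus "pmf (row_distribution A) x = pmf (row_distribution B) x"
      using that assms by (simp add: pmf_row_distribution)
  qed
  have "card (row_distribution ` (carrier_mat n l :: 'a mat set)) \<le> card (cnt ` carrier_mat n l)"
  proof (rule card_inj_on_le)
    \<comment> \<open>\<open>?g\<close> takes the counts of an arbitrarily chosen matrix of the
      type; by \<open>eq\<close> these counts recover the type.\<close>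
    let ?g = "\<lambda>\<tau>. cnt (SOME A. A \<in> carrier_mat n l \<and> row_distribution A = \<tau>)"
    have some: "(SOME A. A \<in> carrier_mat n l \<and> row_distribution A = \<tau>) \<in> carrier_mat n l \<and>
      row_distribution (SOME A. A \<in> carrier_mat n l \<and> row_distribution A = \<tau>) = \<tau>"
      if "\<tau> \<in> row_distribution ` (carrier_mat n l :: 'a mat set)" for \<tau>
      by (rule someI_ex) (use that in auto)
    show "inj_on ?g (row_distribution ` (carrier_mat n l :: 'a mat set))"
    proof (rule inj_onI)
      fix \<tau> \<sigma> assume "\<tau> \<in> row_distribution ` (carrier_mat n l :: 'a mat set)"
        "\<sigma> \<in> row_distribution ` (carrier_mat n l :: 'a mat set)" "?g \<tau> = ?g \<sigma>"
      thus "\<tau> = \<sigma>" using eq[OF conjunct1[OF some] conjunct1[OF some]] some by simp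
    qed
    show "?g ` row_distribution ` (carrier_mat n l :: 'a mat set) \<subseteq> cnt ` carrier_mat n l"
      using some by blast
  qed simp
  also have "\<dots> \<le> card ((carrier_vec l :: 'a vec set) \<rightarrow>\<^sub>E {..n})"
  proof (rule card_mono)
    have "card {i. i < n \<and> row A i = x} \<le> n" for A :: "'a mat" and x
      using card_mono[of "{..<n}" "{i. i < n \<and> row A i = x}"] by auto
    thus "cnt ` (carrier_mat n l :: 'a mat set) \<subseteq> carrier_vec l \<rightarrow>\<^sub>E {..n}"
      by (auto simp: cnt_def)
  qed (auto intro!: finite_PiE)
  also have "\<dots> = (n + 1) ^ (CARD('a) ^ l)"
    by (simp add: card_PiE card_carrier_vec)
  finally show "card (row_distribution ` (carrier_mat n l :: 'a mat set)) \<le> (n + 1) ^ (CARD('a) ^ l)" .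
qed

section \<open>Row permutations and restrictions to subspaces\<close>

definition perm_rows :: "(nat \<Rightarrow> nat) \<Rightarrow> 'a mat \<Rightarrow> 'a mat" where
  "perm_rows p A = mat (dim_row A) (dim_col A) (\<lambda>(i, j). A $$ (p i, j))"

definition perm_vec :: "(nat \<Rightarrow> nat) \<Rightarrow> 'a vec \<Rightarrow> 'a vec" where
  "perm_vec p v = vec (dim_vec v) (\<lambda>i. v $ p i)"

lemma perm_rows_carrier [simp]: "perm_rows p A \<in> carrier_mat n l \<longleftrightarrow> A \<in> carrier_mat n l"
  unfolding carrier_mat_def perm_rows_def by simp

lemma row_perm_rows:
  assumes "p permutes {..<n}" "A \<in> carrier_mat n l" "i < n"
  shows "row (perm_rows p A) i = row A (p i)"
proof -
  have "p i < n" using permutes_in_image[OF assms(1), of i] assms(3) by simp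
  moreover have "dim_row A = n" "dim_col A = l" using assms(2) by auto
  ultimately show ?thesis using assms(3) by (intro eq_vecI) (simp_all add: perm_rows_def)
qed

lemma perm_rows_mult_vec:
  assumes "p permutes {..<n}" "A \<in> carrier_mat n l"
  shows "perm_rows p A *\<^sub>v x = perm_vec p (A *\<^sub>v x)"
proof (rule eq_vecI)
  show "dim_vec (perm_rows p A *\<^sub>v x) = dim_vec (perm_vec p (A *\<^sub>v x))"
    by (simp add: perm_rows_def perm_vec_def)
  fix i assume "i < dim_vec (perm_vec p (A *\<^sub>v x))"
  hence i: "i < n" using assms by (simp add: perm_vec_def)
  have "p i < n" using permutes_in_image[OF assms(1), of i] i by simp
  moreover have "dim_row (perm_rows p A) = n" using assms by (simp add: perm_rows_def)
  ultimately show "(perm_rows p A *\<^sub>v x) $ i = perm_vec p (A *\<^sub>v x) $ i"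
    using i assms row_perm_rows[OF assms i] by (simp add: perm_vec_def)
qed

lemma perm_rows_inv:
  assumes "p permutes {..<n}" "A \<in> carrier_mat n l"
  shows "perm_rows (inv_into UNIV p) (perm_rows p A) = A"
proof (rule eq_matI)
  fix i j assume "i < dim_row A" "j < dim_col A"
  hence ij: "i < n" "j < l" using assms by auto
  have "inv_into UNIV p i < n" using permutes_in_image[OF permutes_inv[OF assms(1)], of i] ij by simp
  thus "perm_rows (inv_into UNIV p) (perm_rows p A) $$ (i, j) = A $$ (i, j)"
    using ij assms by (simp add: perm_rows_def permutes_inverses[OF assms(1)])
qed (auto simp: perm_rows_def)

lemma row_distribution_perm_rows:
  assumes "p permutes {..<n}" "A \<in> carrier_mat n l" "n > 0"
  shows "row_distribution (perm_rows p A) = row_distribution A"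
proof -
  have dim: "dim_row (perm_rows p A) = n" "dim_row A = n" using assms by (auto simp: perm_rows_def)
  have ne: "{..<n} \<noteq> {}" using assms(3) by auto
  have "row_distribution (perm_rows p A) = map_pmf (\<lambda>i. row A (p i)) (pmf_of_set {..<n})"
    unfolding row_distribution_def dim
    by (intro map_pmf_cong refl) (use row_perm_rows[OF assms(1,2)] ne in \<open>auto simp: set_pmf_of_set\<close>)
  also have "\<dots> = map_pmf (row A) (map_pmf p (pmf_of_set {..<n}))"
    by (simp add: pmf.map_comp o_def)
  also have "map_pmf p (pmf_of_set {..<n}) = pmf_of_set (p ` {..<n})"
    by (intro map_pmf_of_set_inj permutes_inj_on[OF assms(1)]) (use ne in auto)
  also have "p ` {..<n} = {..<n}" by (rule permutes_image[OF assms(1)])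
  finally show ?thesis by (simp add: row_distribution_def dim)
qed

text \<open>With the same number of rows, equal distributions mean equal multisets of rows, and such
  matrices are rearrangements of each other.\<close>

lemma row_distribution_eq_obtains_perm:
  assumes A: "A \<in> carrier_mat n l" and B: "B \<in> carrier_mat n l" and n: "n > 0"
    and eq: "row_distribution A = row_distribution B"
  obtains p where "p permutes {..<n}" "B = perm_rows p A"
proof -
  have "card {i. i < n \<and> row B i = x} = card {i. i < n \<and> row A i = x}" for x
    using pmf_row_distribution[OF A n, of x] pmf_row_distribution[OF B n, of x] eq n by simp
  hence "count (image_mset (row B) (mset_set {..<n})) x = count (image_mset (row A) (mset_set {..<n})) x" for x
    by (simp add: count_image_mset_eq_card_vimage)
  then obtain p where p: "p permutes {..<n}" "\<forall>i\<in>{..<n}. row B i = row A (p i)"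
    using image_mset_eq_implies_permutes[of "{..<n}" "row B" "row A"] by (metis finite_lessThan multiset_eqI)
  have "B = perm_rows p A"
  proof (rule eq_rowI)
    show "dim_row B = dim_row (perm_rows p A)" "dim_col B = dim_col (perm_rows p A)"
      using A B by (auto simp: perm_rows_def)
    fix i assume "i < dim_row (perm_rows p A)"
    hence "i < n" using A by (simp add: perm_rows_def)
    thus "row B i = row (perm_rows p A) i" using p row_perm_rows[OF p(1) A] by simp
  qed
  thus thesis using that p by blast
qed

lemma matrices_of_type_obtains_perm:
  assumes "A \<in> matrices_of_type n l \<tau>" "B \<in> matrices_of_type n l \<tau>" "n > 0"
  obtains p where "p permutes {..<n}" "B = perm_rows p A"
  using assms row_distribution_eq_obtains_perm[of A n l B] by (auto simp: matrices_of_type_def)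

lemma perm_rows_in_matrices_of_type:
  assumes "A \<in> matrices_of_type n l \<tau>" "p permutes {..<n}" "n > 0"
  shows "perm_rows p A \<in> matrices_of_type n l \<tau>"
  using assms row_distribution_perm_rows by (auto simp: matrices_of_type_def)

lemma finite_matrices_of_type [simp]: "finite (matrices_of_type n l \<tau> :: 'a::finite mat set)"
  by (rule finite_subset[OF _ finite_carrier_mat]) (auto simp: matrices_of_type_def)

text \<open>Permuting rows only permutes the coordinates of the vectors
  \<open>A *\<^sub>v x\<close>. By symmetry the size of the image of \<open>D\<close> depends on the
  type alone.\<close>

lemma card_image_matrices_of_type_le:
  assumes A: "A \<in> matrices_of_type n l \<tau>" and B: "B \<in> matrices_of_type n l \<tau>" and "n > 0" "finite D"
  shows "card ((\<lambda>x. B *\<^sub>v x) ` D) \<le> card ((\<lambda>x. A *\<^sub>v x) ` D)"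
proof -
  obtain p where p: "p permutes {..<n}" "B = perm_rows p A"
    using matrices_of_type_obtains_perm[OF A B assms(3)] .
  have "(\<lambda>x. B *\<^sub>v x) ` D = perm_vec p ` (\<lambda>x. A *\<^sub>v x) ` D"
    using p A by (auto simp: perm_rows_mult_vec matrices_of_type_def image_image)
  thus ?thesis using assms(4) by (simp add: card_image_le)
qed

lemma card_image_matrices_of_type_eq:
  assumes "A \<in> matrices_of_type n l \<tau>" "B \<in> matrices_of_type n l \<tau>" "n > 0" "finite D"
  shows "card ((\<lambda>x. B *\<^sub>v x) ` D) = card ((\<lambda>x. A *\<^sub>v x) ` D)"
  using card_image_matrices_of_type_le assms by (metis order.antisym)

text \<open>Extensional functions are used so that matrices agreeing on \<open>D\<close> give one
  and the same element, and \<open>card\<close> counts the linear maps on \<open>D\<close> rather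
  than the matrices.\<close>

definition restrictions :: "nat \<Rightarrow> nat \<Rightarrow> 'a::semiring_0 vec pmf \<Rightarrow> 'a vec set \<Rightarrow> ('a vec \<Rightarrow> 'a vec) set" where
  "restrictions n l \<tau> D = (\<lambda>A. restrict (\<lambda>x. A *\<^sub>v x) D) ` matrices_of_type n l \<tau>"

text \<open>Row permutations act transitively on the matrices of a given type.\<close>

lemma card_restriction_fibre:
  fixes A :: "'a::{finite,semiring_0} mat"
  assumes A: "A \<in> matrices_of_type n l \<tau>" and "n > 0"
  shows "card {B \<in> matrices_of_type n l \<tau>. \<forall>x\<in>D. B *\<^sub>v x = A *\<^sub>v x} * card (restrictions n l \<tau> D)
    = card (matrices_of_type n l \<tau>)"
proof -
  let ?M = "matrices_of_type n l \<tau>"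
  let ?F = "\<lambda>A. {B \<in> ?M. \<forall>x\<in>D. B *\<^sub>v x = A *\<^sub>v x}"
  \<comment> \<open>A row permutation carrying \<open>A\<close> to \<open>B\<close> injects the
    fibre through \<open>A\<close> into the fibre through \<open>B\<close>; exchanging the roles
    gives equality.\<close>
  have le: "card (?F A) \<le> card (?F B)" if A: "A \<in> ?M" and B: "B \<in> ?M" for A B
  proof -
    obtain p where p: "p permutes {..<n}" "B = perm_rows p A"
      using matrices_of_type_obtains_perm[OF A B assms(2)] .
    show ?thesis
    proof (rule card_inj_on_le[of "perm_rows p"])
      show "inj_on (perm_rows p) (?F A)"
        by (rule inj_on_inverseI[of _ "perm_rows (inv_into UNIV p)"])
          (use p in \<open>auto simp: matrices_of_type_def perm_rows_inv\<close>)
      show "perm_rows p ` ?F A \<subseteq> ?F B"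
      proof safe
        fix C assume C: "C \<in> ?M" "\<forall>x\<in>D. C *\<^sub>v x = A *\<^sub>v x"
        show "perm_rows p C \<in> ?M" using perm_rows_in_matrices_of_type[OF C(1) p(1) assms(2)] .
        fix x assume "x \<in> D"
        thus "perm_rows p C *\<^sub>v x = B *\<^sub>v x"
          using C A p by (simp add: matrices_of_type_def perm_rows_mult_vec[of p n _ l])
      qed
    qed simp
  qed
  have "card ?M = card (?F A) * card (restrictions n l \<tau> D)"
  proof (rule card_fibres_eq)
    fix y assume "y \<in> restrictions n l \<tau> D"
    then obtain B where B: "B \<in> ?M" "y = restrict (\<lambda>x. B *\<^sub>v x) D" by (auto simp: restrictions_def)
    have "{C \<in> ?M. restrict (\<lambda>x. C *\<^sub>v x) D = y} = ?F B"
      unfolding B(2) by (auto simp: restrict_def fun_eq_iff)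
    thus "card {C \<in> ?M. restrict (\<lambda>x. C *\<^sub>v x) D = y} = card (?F A)"
      using le[OF A B(1)] le[OF B(1) A] by simp
  qed (auto simp: restrictions_def)
  thus ?thesis by simp
qed

section \<open>Two subspaces in the same kernel\<close>

lemma linear_code_diff:
  fixes U :: "'a::finite_field vec set"
  assumes "linear_code n U" "x \<in> U" "y \<in> U"
  shows "x - y \<in> U"
proof -
  have "x \<in> carrier_vec n" "y \<in> carrier_vec n" using assms by (auto simp: linear_code_iff)
  hence "x - y = x + (- 1) \<cdot>\<^sub>v y" by (intro eq_vecI) auto
  thus ?thesis using assms by (simp add: linear_code_iff)
qed

lemma linear_code_Int:
  "linear_code n U \<Longrightarrow> linear_code n U' \<Longrightarrow> linear_code n (U \<inter> U')"
  by (auto simp: linear_code_iff)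

text \<open>A kernel contains \<open>U\<close> and \<open>U'\<close> iff it contains their sum
  \<open>S\<close>, and |S| = |U| |U'| / |U \<inter> U'|. So the two events are correlated exactly
  by the factor |U \<inter> U'|^m, which drives the variance computation.\<close>

lemma card_kernel_contains_two:
  fixes U U' :: "'a::finite_field vec set"
  assumes U: "linear_code n U" and U': "linear_code n U'"
  shows "card {H \<in> carrier_mat m n. U \<subseteq> mat_kernel H \<and> U' \<subseteq> mat_kernel H} * (card U * card U') ^ m
    = card (carrier_mat m n :: 'a mat set) * card (U \<inter> U') ^ m"
proof -
  note lc = U[unfolded linear_code_iff] U'[unfolded linear_code_iff]
  have car: "x \<in> carrier_vec n" if "x \<in> U \<or> x \<in> U'" for x using lc that by auto
  have fin: "finite U" "finite U'" using lc finite_carrier_vec finite_subset by blast+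
  define S where "S = (\<lambda>(u, u'). u + u') ` (U \<times> U')"
  have S: "linear_code n S" unfolding linear_code_iff
  proof (intro conjI ballI allI)
    show "S \<subseteq> carrier_vec n" using car by (auto simp: S_def)
    show "0\<^sub>v n \<in> S" unfolding S_def using lc by (intro image_eqI[of _ _ "(0\<^sub>v n, 0\<^sub>v n)"]) auto
    fix c x assume "x \<in> S"
    then obtain u u' where x: "x = u + u'" "u \<in> U" "u' \<in> U'" by (auto simp: S_def)
    show "c \<cdot>\<^sub>v x \<in> S" unfolding S_def
      using lc x car by (intro image_eqI[of _ _ "(c \<cdot>\<^sub>v u, c \<cdot>\<^sub>v u')"]) (auto simp: smult_add_distrib_vec[of _ n])
    fix y assume "y \<in> S"
    then obtain v v' where y: "y = v + v'" "v \<in> U" "v' \<in> U'" by (auto simp: S_def)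
    have "u \<in> carrier_vec n" "u' \<in> carrier_vec n" "v \<in> carrier_vec n" "v' \<in> carrier_vec n"
      using car x y by auto
    hence "x + y = (u + v) + (u' + v')" unfolding x y by (intro eq_vecI) auto
    thus "x + y \<in> S" unfolding S_def
      using lc x y by (intro image_eqI[of _ _ "(u + v, u' + v')"]) auto
  qed
  have "card (U \<times> U') = card (U \<inter> U') * card S"
  proof (rule card_fibres_eq[where f = "\<lambda>(u, u'). u + u'"])
    fix y assume "y \<in> S"
    then obtain u u' where y: "y = u + u'" "u \<in> U" "u' \<in> U'" by (auto simp: S_def)
    \<comment> \<open>One decomposition of \<open>y\<close> is fixed; any other one differs from it
      by v - u = u' - v', which lies in both subspaces. So the fibre is a copy of the
      intersection.\<close>
    have f: "u + (v - u) = v \<and> u' - (v - u) = v' \<and> v - u \<in> U \<inter> U'"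
      if v: "v \<in> U" "v' \<in> U'" "v + v' = y" for v v'
    proof -
      have c: "u \<in> carrier_vec n" "u' \<in> carrier_vec n" "v \<in> carrier_vec n" "v' \<in> carrier_vec n"
        using car v y by auto
      have e: "v $ i + v' $ i = u $ i + u' $ i" if "i < n" for i
        using arg_cong[OF v(3)[unfolded y], of "\<lambda>z :: 'a vec. z $ i"] c that by simp
      have "v - u = u' - v'"
      proof (rule eq_vecI)
        fix i assume "i < dim_vec (u' - v')"
        hence "i < n" using c by simp
        moreover have "a - x = y - b" if "a + b = x + y" for a b x y :: 'a
        proof -
          have "a = x + y - b" using that by (simp add: eq_diff_eq)
          thus ?thesis by simp
        qed
        ultimately show "(v - u) $ i = (u' - v') $ i" using c e[of i] by simp
      qed (use c in simp)
      moreover have "u' - (u' - v') = v'" "u + (v - u) = v" using c by (intro eq_vecI; simp)+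
      moreover have "v - u \<in> U" "u' - v' \<in> U'"
        using linear_code_diff[OF U] linear_code_diff[OF U'] v y by auto
      ultimately show ?thesis by simp
    qed
    have g: "u + w - u = w \<and> u + w \<in> U \<and> u' - w \<in> U' \<and> u + w + (u' - w) = y"
      if w: "w \<in> U" "w \<in> U'" for w
    proof -
      have c: "u \<in> carrier_vec n" "u' \<in> carrier_vec n" "w \<in> carrier_vec n" using car w y by auto
      have "u + w - u = w" "u + w + (u' - w) = y" using c y(1) by (intro eq_vecI; simp)+
      thus ?thesis using linear_code_diff[OF U'] w y lc by auto
    qed
    show "card {x \<in> U \<times> U'. (case x of (v, v') \<Rightarrow> v + v') = y} = card (U \<inter> U')"
    proof (rule bij_betw_same_card[of "\<lambda>(v, v'). v - u"],
        rule bij_betw_byWitness[where f' = "\<lambda>w. (u + w, u' - w)"])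
      show "\<forall>x\<in>{x \<in> U \<times> U'. (case x of (v, v') \<Rightarrow> v + v') = y}.
          (u + (case x of (v, v') \<Rightarrow> v - u), u' - (case x of (v, v') \<Rightarrow> v - u)) = x"
        using f by fastforce
      show "(\<lambda>(v, v'). v - u) ` {x \<in> U \<times> U'. (case x of (v, v') \<Rightarrow> v + v') = y} \<subseteq> U \<inter> U'"
        using f by fastforce
      show "\<forall>w\<in>U \<inter> U'. (case (u + w, u' - w) of (v, v') \<Rightarrow> v - u) = w"
        "(\<lambda>w. (u + w, u' - w)) ` (U \<inter> U') \<subseteq> {x \<in> U \<times> U'. (case x of (v, v') \<Rightarrow> v + v') = y}"
        using g by (simp_all add: image_subset_iff)
    qed
  qed (use fin in \<open>auto simp: S_def\<close>)
  hence cards: "card U * card U' = card (U \<inter> U') * card S" by (simp add: card_cartesian_product)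
  have "{H \<in> carrier_mat m n. U \<subseteq> mat_kernel H \<and> U' \<subseteq> mat_kernel H} = {H \<in> carrier_mat m n. S \<subseteq> mat_kernel H}"
  proof (intro Collect_cong conj_cong refl)
    fix H :: "'a mat" assume H: "H \<in> carrier_mat m n"
    have sub: "U \<subseteq> S" "U' \<subseteq> S"
    proof safe
      fix x assume x: "x \<in> U" thus "x \<in> S" unfolding S_def
        using lc car by (intro image_eqI[of _ _ "(x, 0\<^sub>v n)"]) auto
    next
      fix x assume x: "x \<in> U'" thus "x \<in> S" unfolding S_def
        using lc car by (intro image_eqI[of _ _ "(0\<^sub>v n, x)"]) auto
    qed
    show "U \<subseteq> mat_kernel H \<and> U' \<subseteq> mat_kernel H \<longleftrightarrow> S \<subseteq> mat_kernel H"
      using linear_code_mat_kernel[OF H] sub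
      unfolding linear_code_iff by (auto simp: S_def subset_iff)
  qed
  thus ?thesis using card_kernel_contains[OF S, of m] unfolding cards
    by (simp add: power_mult_distrib mult_ac)
qed

section \<open>The second moment method for random linear codes\<close>

text \<open>
  The number of subsets \<open>D\<close> and self-maps \<open>g\<close> of \<open>F\<^sub>q\<^sup>l\<close>, times \<open>4\<close> to make the
  relative variance in the second moment bound at most \<open>1/4\<close>.
\<close>

definition type_const :: "nat \<Rightarrow> nat \<Rightarrow> nat" where
  "type_const q l = 4 * (2 ^ (q ^ l) * (q ^ l) ^ (q ^ l))"

text \<open>Chebyshev's inequality at 0 in counting form: every zero of \<open>Y\<close> contributes
  mu^2 to the sum of (Y - mu)^2, which is at most (c - 1) mu^2 |\<Omega>|.\<close>

lemma chebyshev_card: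
  fixes Y :: "'h \<Rightarrow> real" and mu c :: real
  assumes fin: "finite \<Omega>" and mean: "(\<Sum>H\<in>\<Omega>. Y H) = mu * card \<Omega>"
    and second: "(\<Sum>H\<in>\<Omega>. (Y H)\<^sup>2) \<le> c * mu\<^sup>2 * card \<Omega>" and "mu > 0"
  shows "card {H \<in> \<Omega>. Y H = 0} \<le> (c - 1) * card \<Omega>"
proof -
  have "mu\<^sup>2 * card {H \<in> \<Omega>. Y H = 0} = (\<Sum>H | H \<in> \<Omega> \<and> Y H = 0. (Y H - mu)\<^sup>2)"
    by simp
  also have "\<dots> \<le> (\<Sum>H\<in>\<Omega>. (Y H - mu)\<^sup>2)"
    using fin by (intro sum_mono2) auto
  also have "\<dots> = (\<Sum>H\<in>\<Omega>. (Y H)\<^sup>2) - 2 * mu * (\<Sum>H\<in>\<Omega>. Y H) + mu\<^sup>2 * card \<Omega>"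
    by (simp add: power2_diff sum.distrib sum_subtractf mult_ac flip: sum_distrib_left sum_distrib_right)
  also have "\<dots> \<le> mu\<^sup>2 * ((c - 1) * card \<Omega>)"
    using second unfolding mean by (simp add: algebra_simps power2_eq_square)
  finally show ?thesis using \<open>mu > 0\<close> by simp
qed

lemma finite_linear_code: "linear_code n C \<Longrightarrow> finite (C :: 'a::finite_field vec set)"
  using finite_carrier_vec finite_subset unfolding linear_code_iff by blast

lemma card_linear_code_pos: "linear_code n C \<Longrightarrow> 0 < card (C :: 'a::finite_field vec set)"
  using finite_linear_code[of n C] unfolding linear_code_iff by (auto simp: card_gt_0_iff)

text \<open>
  If the column spaces of \<open>A\<close> and \<open>B\<close> meet in \<open>W\<close>, then \<open>B\<close> agrees with \<open>A \<circ> g\<close> on the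
  preimage \<open>D\<close> of \<open>W\<close> for some map \<open>g\<close>. There are boundedly many pairs \<open>(D, g)\<close>, and each of
  them determines the restriction of \<open>B\<close> to \<open>D\<close>.
\<close>

lemma sum_card_column_space_Int_le:
  fixes A :: "'a::finite_field mat"
  assumes A: "A \<in> matrices_of_type n l \<tau>" and n: "n > 0"
    and large: "\<And>D. linear_code l D \<Longrightarrow> 1 < card ((\<lambda>x. A *\<^sub>v x) ` D) \<Longrightarrow>
      type_const CARD('a) l * card ((\<lambda>x. A *\<^sub>v x) ` D) ^ m \<le> card (restrictions n l \<tau> D)"
  shows "(\<Sum>B\<in>matrices_of_type n l \<tau>.
      real (card ((\<lambda>x. A *\<^sub>v x) ` carrier_vec l \<inter> (\<lambda>x. B *\<^sub>v x) ` carrier_vec l)) ^ m)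
    \<le> 5 / 4 * card (matrices_of_type n l \<tau>)"
proof -
  let ?M = "matrices_of_type n l \<tau>" and ?V = "carrier_vec l :: 'a vec set"
  let ?N = "\<lambda>D. card ((\<lambda>x. A *\<^sub>v x) ` D)"
  let ?I = "\<lambda>B. (\<lambda>x. A *\<^sub>v x) ` ?V \<inter> (\<lambda>x. B *\<^sub>v x) ` ?V"
  have Ac: "A \<in> carrier_mat n l" using A by (simp add: matrices_of_type_def)
  have V: "linear_code l ?V" by (auto simp: linear_code_iff)
  have I: "linear_code n (?I B)" if "B \<in> ?M" for B
    using that Ac by (intro linear_code_Int linear_code_image_mat[OF _ V]) (auto simp: matrices_of_type_def)
  \<comment> \<open>A pair \<open>(D, g)\<close> records one possible nontrivial overlap with the
    column space of \<open>A\<close>; \<open>S\<close> collects the matrices that show it, and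
    \<open>w\<close> is the resulting m-th power of the intersection size.\<close>
  define P where "P = {D. linear_code l D \<and> 1 < ?N D} \<times> (?V \<rightarrow>\<^sub>E ?V)"
  define S where "S = (\<lambda>(D, g). {B \<in> ?M. \<forall>x\<in>D. B *\<^sub>v x = A *\<^sub>v g x})"
  define w where "w = (\<lambda>(D, g :: 'a vec \<Rightarrow> 'a vec). real (?N D) ^ m)"
  have sub: "{D. linear_code l D \<and> 1 < ?N D} \<subseteq> Pow ?V" unfolding linear_code_iff by fast
  have fin: "finite (Pow ?V \<times> (?V \<rightarrow>\<^sub>E ?V))"
    by (intro finite_cartesian_product finite_PiE) simp_all
  have subP: "P \<subseteq> Pow ?V \<times> (?V \<rightarrow>\<^sub>E ?V)" unfolding P_def using sub by (intro Sigma_mono) simp_all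
  have finP: "finite P" by (rule finite_subset[OF subP fin])
  have "card P \<le> card (Pow ?V \<times> (?V \<rightarrow>\<^sub>E ?V))" by (rule card_mono[OF fin subP])
  hence cardP: "4 * card P \<le> type_const CARD('a) l"
    by (simp add: type_const_def card_cartesian_product card_Pow card_PiE card_carrier_vec)
  have type_const_pos: "0 < type_const CARD('a) l"
    unfolding type_const_def by simp
  \<comment> \<open>If \<open>S p\<close> is nonempty it lies in a single fibre of the restriction
    to \<open>D\<close>. By transitivity that fibre has size |M| divided by the number of
    restrictions, so \<open>large\<close> bounds its weight.\<close>
  have weight: "real (card (S p)) * w p \<le> card ?M / type_const CARD('a) l" if p: "p \<in> P" for p
  proof (cases "S p = {}")
    case False
    obtain D g where Dg: "p = (D, g)" "linear_code l D" "1 < ?N D" using p by (auto simp: P_def)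
    obtain B where B: "B \<in> S p" using False by auto
    have BM: "B \<in> ?M" using B by (auto simp: S_def Dg)
    have "S p \<subseteq> {C \<in> ?M. \<forall>x\<in>D. C *\<^sub>v x = B *\<^sub>v x}" using B by (auto simp: S_def Dg)
    hence "card (S p) \<le> card {C \<in> ?M. \<forall>x\<in>D. C *\<^sub>v x = B *\<^sub>v x}" by (intro card_mono) auto
    hence "card (S p) * (type_const CARD('a) l * ?N D ^ m)
        \<le> card {C \<in> ?M. \<forall>x\<in>D. C *\<^sub>v x = B *\<^sub>v x} * card (restrictions n l \<tau> D)"
      using large[OF Dg(2,3)] by (rule mult_le_mono)
    also have "\<dots> = card ?M" by (rule card_restriction_fibre[OF BM n])
    finally have "real (card (S p) * (type_const CARD('a) l * ?N D ^ m)) \<le> real (card ?M)"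
      by (simp only: of_nat_le_iff)
    thus ?thesis using type_const_pos by (simp add: w_def Dg(1) field_simps)
  qed simp
  have cover: "\<exists>p\<in>P. B \<in> S p \<and> w p = real (card (?I B)) ^ m"
    if B: "B \<in> ?M" and gt: "1 < card (?I B)" for B
  proof -
    have Bc: "B \<in> carrier_mat n l" using B by (simp add: matrices_of_type_def)
    define D where "D = {x \<in> ?V. B *\<^sub>v x \<in> (\<lambda>x. A *\<^sub>v x) ` ?V}"
    have AV: "linear_code n ((\<lambda>x. A *\<^sub>v x) ` ?V)" by (rule linear_code_image_mat[OF Ac V])
    have D: "linear_code l D" unfolding linear_code_iff
    proof (intro conjI ballI allI)
      have "B *\<^sub>v 0\<^sub>v l = 0\<^sub>v n" using Bc by auto
      thus "0\<^sub>v l \<in> D" using AV by (simp add: D_def linear_code_iff)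
      fix x c assume x: "x \<in> D"
      thus "c \<cdot>\<^sub>v x \<in> D" using AV Bc by (auto simp: D_def linear_code_iff mult_mat_vec[of _ n l])
      fix y assume "y \<in> D"
      thus "x + y \<in> D" using x AV Bc by (auto simp: D_def linear_code_iff mult_add_distrib_mat_vec[of _ n l])
    qed (auto simp: D_def)
    have BD: "(\<lambda>x. B *\<^sub>v x) ` D = ?I B"
    proof (intro equalityI subsetI)
      fix y assume "y \<in> (\<lambda>x. B *\<^sub>v x) ` D"
      then obtain x where "x \<in> D" "y = B *\<^sub>v x" by (rule imageE)
      thus "y \<in> ?I B" by (simp add: D_def)
    next
      fix y assume y: "y \<in> ?I B"
      then obtain x where x: "x \<in> ?V" "y = B *\<^sub>v x" by (elim IntE imageE)
      hence "x \<in> D" using y by (simp add: D_def)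
      thus "y \<in> (\<lambda>x. B *\<^sub>v x) ` D" using x(2) by (intro image_eqI)
    qed
    hence ND: "?N D = card (?I B)"
      using card_image_matrices_of_type_eq[OF A B n finite_linear_code[OF D]] by simp
    \<comment> \<open>On \<open>D\<close> the map chooses a preimage under \<open>A\<close>; the
      value 0 on the rest of F_q^l only serves to make \<open>g\<close> one of the finitely many
      self-maps counted by \<open>type_const\<close>.\<close>
    define g where "g = restrict (\<lambda>x. if x \<in> D then SOME y. y \<in> ?V \<and> B *\<^sub>v x = A *\<^sub>v y else 0\<^sub>v l) ?V"
    have some: "(SOME y. y \<in> ?V \<and> B *\<^sub>v x = A *\<^sub>v y) \<in> ?V \<and> B *\<^sub>v x = A *\<^sub>v (SOME y. y \<in> ?V \<and> B *\<^sub>v x = A *\<^sub>v y)"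
      if "x \<in> D" for x
      by (rule someI_ex) (use that in \<open>auto simp: D_def\<close>)
    have "(D, g) \<in> P" unfolding P_def using D ND gt some by (auto simp: g_def)
    moreover have "B \<in> S (D, g)" using B some by (auto simp: S_def g_def D_def)
    ultimately show ?thesis using ND by (intro bexI[of _ "(D, g)"]) (auto simp: w_def)
  qed
  \<comment> \<open>A trivial intersection accounts for the summand 1, a larger one is charged to
    its pair. The pairs together add at most a quarter of |M|, whence the constant 5/4.\<close>
  have "(\<Sum>B\<in>?M. real (card (?I B)) ^ m) \<le> (\<Sum>B\<in>?M. 1 + (\<Sum>p\<in>P. if B \<in> S p then w p else 0))"
  proof (rule sum_mono)
    fix B assume B: "B \<in> ?M"
    have w0: "0 \<le> w p" for p by (auto simp: w_def split: prod.splits)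
    show "real (card (?I B)) ^ m \<le> 1 + (\<Sum>p\<in>P. if B \<in> S p then w p else 0)"
    proof (cases "1 < card (?I B)")
      case True
      obtain p where p: "p \<in> P" "B \<in> S p" "w p = real (card (?I B)) ^ m"
        using cover[OF B True] by blast
      have "(if B \<in> S p then w p else 0) \<le> (\<Sum>p\<in>P. if B \<in> S p then w p else 0)"
        by (rule member_le_sum) (use p finP w0 in auto)
      thus ?thesis using p by simp
    next
      case False
      hence "card (?I B) = 1" using card_linear_code_pos[OF I[OF B]] by linarith
      moreover have "0 \<le> (\<Sum>p\<in>P. if B \<in> S p then w p else 0)" by (intro sum_nonneg) (simp add: w0)
      ultimately show ?thesis by simp
    qed
  qed
  also have "\<dots> = card ?M + (\<Sum>p\<in>P. \<Sum>B\<in>?M. if B \<in> S p then w p else 0)"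
    by (simp add: sum.distrib sum.swap[of _ P])
  also have "(\<Sum>p\<in>P. \<Sum>B\<in>?M. if B \<in> S p then w p else 0) = (\<Sum>p\<in>P. real (card (S p)) * w p)"
  proof (rule sum.cong[OF refl])
    fix p
    have "?M \<inter> S p = S p" by (auto simp: S_def split: prod.splits)
    thus "(\<Sum>B\<in>?M. if B \<in> S p then w p else 0) = real (card (S p)) * w p"
      by (simp add: sum.inter_restrict[symmetric])
  qed
  also have "\<dots> \<le> (\<Sum>p\<in>P. card ?M / type_const CARD('a) l)"
    by (intro sum_mono weight)
  also have "\<dots> = card P / type_const CARD('a) l * card ?M" by simp
  also have "\<dots> \<le> 1 / 4 * card ?M"
  proof (rule mult_right_mono)
    have "4 * real (card P) \<le> real (type_const CARD('a) l)" using cardP by linarith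
    thus "real (card P) / type_const CARD('a) l \<le> 1 / 4" using type_const_pos by (simp add: field_simps)
  qed simp
  finally show ?thesis by simp
qed

text \<open>\<open>Y\<close> counts the matrices of the type whose columns lie in the kernel. Its
  mean is |M| / N^m, and its second moment divided by the squared mean is the average of |U B
  \<inter> U C|^m over pairs, at most 5/4 by the previous lemma. Chebyshev then leaves at most a
  quarter of the kernels.\<close>

lemma card_kernels_avoiding_type_le:
  fixes A :: "'a::finite_field mat"
  assumes A: "A \<in> matrices_of_type n l \<tau>" and n: "n > 0"
    and large: "\<And>D. linear_code l D \<Longrightarrow> 1 < card ((\<lambda>x. A *\<^sub>v x) ` D) \<Longrightarrow>
      type_const CARD('a) l * card ((\<lambda>x. A *\<^sub>v x) ` D) ^ m \<le> card (restrictions n l \<tau> D)"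
  shows "real (card {H \<in> carrier_mat m n. \<forall>B\<in>matrices_of_type n l \<tau>. \<not> columns_in B (mat_kernel H)})
    \<le> 1 / 4 * card (carrier_mat m n :: 'a mat set)"
proof -
  let ?M = "matrices_of_type n l \<tau>" and ?V = "carrier_vec l :: 'a vec set"
  let ?\<Omega> = "carrier_mat m n :: 'a mat set"
  let ?U = "\<lambda>B. (\<lambda>x. B *\<^sub>v x) ` ?V"
  define N where "N = card (?U A)"
  have V: "linear_code l ?V" by (auto simp: linear_code_iff)
  have carr: "B \<in> carrier_mat n l" if "B \<in> ?M" for B using that by (simp add: matrices_of_type_def)
  have U: "linear_code n (?U B)" if "B \<in> ?M" for B
    by (rule linear_code_image_mat[OF carr[OF that] V])
  have N: "card (?U B) = N" if "B \<in> ?M" for B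
    unfolding N_def by (rule card_image_matrices_of_type_eq[OF A that n]) simp
  have Npos: "0 < N" unfolding N_def by (rule card_linear_code_pos[OF U[OF A]])
  have Mpos: "0 < card ?M" using A by (auto simp: card_gt_0_iff)
  define Y where "Y = (\<lambda>H. \<Sum>B\<in>?M. if ?U B \<subseteq> mat_kernel H then 1 else 0 :: real)"
  define mu where "mu = card ?M / real N ^ m"
  have mean: "(\<Sum>H\<in>?\<Omega>. Y H) = mu * card ?\<Omega>"
  proof -
    have "(\<Sum>H\<in>?\<Omega>. Y H) = (\<Sum>B\<in>?M. real (card {H \<in> ?\<Omega>. ?U B \<subseteq> mat_kernel H}))"
      unfolding Y_def by (subst sum.swap) (simp add: sum.If_cases Int_def)
    also have "\<dots> = (\<Sum>B\<in>?M. card ?\<Omega> / real N ^ m)"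
    proof (rule sum.cong[OF refl])
      fix B assume B: "B \<in> ?M"
      have "real (card {H \<in> ?\<Omega>. ?U B \<subseteq> mat_kernel H} * N ^ m) = real (card ?\<Omega>)"
        using card_kernel_contains[OF U[OF B], of m] N[OF B] by simp
      thus "real (card {H \<in> ?\<Omega>. ?U B \<subseteq> mat_kernel H}) = card ?\<Omega> / real N ^ m"
        using Npos by (simp add: field_simps)
    qed
    finally show ?thesis by (simp add: mu_def)
  qed
  have second: "(\<Sum>H\<in>?\<Omega>. (Y H)\<^sup>2) \<le> 5 / 4 * mu\<^sup>2 * card ?\<Omega>"
  proof -
    have "(\<Sum>H\<in>?\<Omega>. (Y H)\<^sup>2) = (\<Sum>H\<in>?\<Omega>. \<Sum>B\<in>?M. \<Sum>C\<in>?M. if ?U B \<subseteq> mat_kernel H \<and> ?U C \<subseteq> mat_kernel H then 1 else 0)"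
      unfolding Y_def power2_eq_square sum_product by (intro sum.cong refl) auto
    also have "\<dots> = (\<Sum>B\<in>?M. \<Sum>H\<in>?\<Omega>. \<Sum>C\<in>?M. if ?U B \<subseteq> mat_kernel H \<and> ?U C \<subseteq> mat_kernel H then 1 else 0)"
      by (rule sum.swap)
    also have "\<dots> = (\<Sum>B\<in>?M. \<Sum>C\<in>?M. \<Sum>H\<in>?\<Omega>. if ?U B \<subseteq> mat_kernel H \<and> ?U C \<subseteq> mat_kernel H then 1 else 0)"
      by (intro sum.cong refl sum.swap)
    also have "\<dots> = (\<Sum>B\<in>?M. \<Sum>C\<in>?M. real (card {H \<in> ?\<Omega>. ?U B \<subseteq> mat_kernel H \<and> ?U C \<subseteq> mat_kernel H}))"
      by (simp add: sum.If_cases Int_def)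
    also have "\<dots> = (\<Sum>B\<in>?M. \<Sum>C\<in>?M. card ?\<Omega> / (real N ^ m)\<^sup>2 * real (card (?U B \<inter> ?U C)) ^ m)"
    proof (intro sum.cong refl)
      fix B C assume B: "B \<in> ?M" and C: "C \<in> ?M"
      have "real (card {H \<in> ?\<Omega>. ?U B \<subseteq> mat_kernel H \<and> ?U C \<subseteq> mat_kernel H} * (N * N) ^ m)
          = real (card ?\<Omega> * card (?U B \<inter> ?U C) ^ m)"
        using card_kernel_contains_two[OF U[OF B] U[OF C], of m] N[OF B] N[OF C] by simp
      thus "real (card {H \<in> ?\<Omega>. ?U B \<subseteq> mat_kernel H \<and> ?U C \<subseteq> mat_kernel H})
          = card ?\<Omega> / (real N ^ m)\<^sup>2 * real (card (?U B \<inter> ?U C)) ^ m"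
        using Npos by (simp add: field_simps power2_eq_square power_mult_distrib)
    qed
    also have "\<dots> = card ?\<Omega> / (real N ^ m)\<^sup>2 * (\<Sum>B\<in>?M. \<Sum>C\<in>?M. real (card (?U B \<inter> ?U C)) ^ m)"
      by (simp add: sum_distrib_left)
    also have "\<dots> \<le> card ?\<Omega> / (real N ^ m)\<^sup>2 * (\<Sum>B\<in>?M. 5 / 4 * real (card ?M))"
    proof (intro mult_left_mono sum_mono)
      fix B assume B: "B \<in> ?M"
      show "(\<Sum>C\<in>?M. real (card (?U B \<inter> ?U C)) ^ m) \<le> 5 / 4 * real (card ?M)"
      proof (rule sum_card_column_space_Int_le[OF B n])
        fix D assume D: "linear_code l D" "1 < card ((\<lambda>x. B *\<^sub>v x) ` D)"
        \<comment> \<open>The hypothesis \<open>large\<close> speaks about \<open>A\<close>, but the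
          image sizes in it are the same for every matrix of the type.\<close>
        have "card ((\<lambda>x. B *\<^sub>v x) ` D) = card ((\<lambda>x. A *\<^sub>v x) ` D)"
          by (rule card_image_matrices_of_type_eq[OF A B n finite_linear_code[OF D(1)]])
        thus "type_const CARD('a) l * card ((\<lambda>x. B *\<^sub>v x) ` D) ^ m \<le> card (restrictions n l \<tau> D)"
          using large D by simp
      qed
    qed simp
    also have "\<dots> = 5 / 4 * mu\<^sup>2 * card ?\<Omega>"
      by (simp add: mu_def power2_eq_square mult_ac)
    finally show ?thesis .
  qed
  have "{H \<in> ?\<Omega>. \<forall>B\<in>?M. \<not> columns_in B (mat_kernel H)} = {H \<in> ?\<Omega>. Y H = 0}"
  proof (intro Collect_cong conj_cong refl)
    fix H assume H: "H \<in> ?\<Omega>"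
    have "columns_in B (mat_kernel H) \<longleftrightarrow> ?U B \<subseteq> mat_kernel H" if "B \<in> ?M" for B
      by (rule columns_in_iff[OF carr[OF that] linear_code_mat_kernel[OF H]])
    thus "(\<forall>B\<in>?M. \<not> columns_in B (mat_kernel H)) \<longleftrightarrow> Y H = 0"
      unfolding Y_def by (subst sum_nonneg_eq_0_iff) auto
  qed
  moreover have "real (card {H \<in> ?\<Omega>. Y H = 0}) \<le> (5 / 4 - 1) * card ?\<Omega>"
    by (rule chebyshev_card[OF _ mean second]) (use Mpos Npos in \<open>auto simp: mu_def\<close>)
  ultimately show ?thesis by simp
qed

section \<open>PCLP codes\<close>

lemma linearized_eval_upd_0:
  fixes x :: "'a::finite_field alg_closure"
  assumes "1 \<le> l"
  shows "linearized_eval l (f(0 := f 0 + a)) x = linearized_eval l f x + a * x"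
proof -
  have "linearized_eval l g x = g 0 * x + (\<Sum>i\<in>{..<l} - {0}. g i * x ^ (CARD('a) ^ i))" for g
    unfolding linearized_eval_def using assms by (subst sum.remove[of _ 0]) auto
  thus ?thesis by (simp add: algebra_simps)
qed

text \<open>\<open>code_dim\<close> is the dimension of the module with its carrier replaced by
  \<open>C\<close>, so it is computed by transporting the known dimension of F_q^k along a linear
  bijection.\<close>

lemma code_dim_eqI:
  fixes T :: "'a::finite_field vec \<Rightarrow> 'a vec"
  assumes C: "linear_code n C"
    and bij: "bij_betw T (carrier_vec k) C"
    and add: "\<And>x y. x \<in> carrier_vec k \<Longrightarrow> y \<in> carrier_vec k \<Longrightarrow> T (x + y) = T x + T y"
    and smult: "\<And>c x. x \<in> carrier_vec k \<Longrightarrow> T (c \<cdot>\<^sub>v x) = c \<cdot>\<^sub>v T x"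
  shows "code_dim n C = k"
proof -
  interpret K: vec_space "TYPE('a)" k .
  interpret N: vec_space "TYPE('a)" n .
  have W: "vectorspace class_ring ((module_vec TYPE('a) n)\<lparr>carrier := C\<rparr>)"
    using N.subspace_is_vs[of C] C by (simp add: linear_code_def)
  interpret W: vectorspace class_ring "(module_vec TYPE('a) n)\<lparr>carrier := C\<rparr>" by (rule W)
  interpret T: linear_map class_ring "module_vec TYPE('a) k" "(module_vec TYPE('a) n)\<lparr>carrier := C\<rparr>" T
    by unfold_locales
      (use bij add smult in \<open>auto simp: module_hom_def module_vec_simps class_ring_simps bij_betw_def\<close>)
  have "K.dim = W.dim"
    by (rule T.dim_eq) (use bij in \<open>auto simp: bij_betw_def module_vec_simps\<close>)
  thus ?thesis by (simp add: code_dim_def K.dim_is_n)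
qed

section \<open>PCLP codes over a fixed adapted basis\<close>

locale pclp =
  fixes n k l :: nat and V :: "'a::finite_field alg_closure set" and \<alpha> :: "nat \<Rightarrow> 'a alg_closure"
  assumes adapted: "adapted_basis n k V \<alpha>" and k: "1 \<le> k" "k \<le> n" and l: "1 \<le> l"
begin

abbreviation E :: "'a alg_closure set" where "E \<equiv> ext_field n"
abbreviation \<phi> :: "'a alg_closure \<Rightarrow> 'a vec" where "\<phi> \<equiv> coord_map n \<alpha>"
text \<open>Coefficient families take the default value 0 beyond l, in accordance with
  \<open>Pi_pmf\<close> in \<open>PCLP\<close>; this makes the sample space finite.\<close>

abbreviation F :: "(nat \<Rightarrow> 'a alg_closure) set" where "F \<equiv> PiE_dflt {..<l} 0 (\<lambda>_. E)"

definition pclp_code :: "(nat \<Rightarrow> 'a alg_closure) \<Rightarrow> 'a vec set" where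
  "pclp_code f = (\<lambda>x. \<phi> (linearized_eval l f x)) ` V"

lemma basis: "ac.independent (\<alpha> ` {..<n})" "ac.span (\<alpha> ` {..<n}) = E" "card (\<alpha> ` {..<n}) = n"
  and inj_\<alpha>: "inj_on \<alpha> {..<n}"
  using adapted by (auto simp: adapted_basis_def card_image)

lemma finite_E [simp]: "finite E" and card_E: "card E = CARD('a) ^ n"
  using ac_card_span[OF _ basis(1)] by (simp_all add: basis)

lemma subspace_E: "ac.subspace E"
  using ac.subspace_span[of "\<alpha> ` {..<n}"] by (simp add: basis)

lemma V_def: "V = ac.span (\<alpha> ` {..<k})"
  using adapted by (simp add: adapted_basis_def)

lemma subspace_V: "ac.subspace V"
  unfolding V_def by simp

lemma V_subset_E: "V \<subseteq> E"
  unfolding V_def basis(2)[symmetric] using k by (intro ac.span_mono image_mono) auto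

lemma finite_V [simp]: "finite V" and card_V: "card V = CARD('a) ^ k"
proof -
  have ind: "ac.independent (\<alpha> ` {..<k})"
    by (rule ac.independent_mono[OF basis(1)]) (use k in auto)
  have "card (\<alpha> ` {..<k}) = k"
    using k by (subst card_image) (auto intro: inj_on_subset[OF inj_\<alpha>])
  thus "finite V" "card V = CARD('a) ^ k"
    using ac_card_span[OF _ ind] by (simp_all add: V_def)
qed

lemma E_mult: "x \<in> E \<Longrightarrow> y \<in> E \<Longrightarrow> x * y \<in> E"
  by (simp add: ext_field_def power_mult_distrib)

lemma E_divide: "x \<in> E \<Longrightarrow> y \<in> E \<Longrightarrow> x / y \<in> E"
  by (simp add: ext_field_def power_divide)

lemma E_power: "x \<in> E \<Longrightarrow> x ^ i \<in> E"
  by (simp add: ext_field_def power_commutes flip: power_mult) (metis mult.commute power_mult)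

lemma linearized_eval_in_E: "f \<in> F \<Longrightarrow> x \<in> E \<Longrightarrow> linearized_eval l f x \<in> E"
  unfolding linearized_eval_def
  by (intro ac.subspace_sum[OF subspace_E] E_mult E_power) (auto simp: PiE_dflt_def)

lemma coord_carrier [simp]: "\<phi> x \<in> carrier_vec n"
  by (simp add: coord_map_def)

lemma coord_add: "x \<in> E \<Longrightarrow> y \<in> E \<Longrightarrow> \<phi> (x + y) = \<phi> x + \<phi> y"
  unfolding coord_map_def by (intro eq_vecI) (simp_all add: ac.representation_add[OF basis(1)] basis(2))

lemma coord_scale: "x \<in> E \<Longrightarrow> \<phi> (ac_scale c x) = c \<cdot>\<^sub>v \<phi> x"
  unfolding coord_map_def by (intro eq_vecI) (simp_all add: ac.representation_scale[OF basis(1)] basis(2))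

lemma coord_zero: "\<phi> 0 = 0\<^sub>v n"
  unfolding coord_map_def by (intro eq_vecI) (simp_all add: ac.representation_zero)

lemma coord_eq_iff:
  assumes "x \<in> E" "y \<in> E"
  shows "\<phi> x = \<phi> y \<longleftrightarrow> x = y"
proof
  assume eq: "\<phi> x = \<phi> y"
  let ?r = "ac.representation (\<alpha> ` {..<n})"
  have "?r x b = ?r y b" if b: "b \<in> \<alpha> ` {..<n}" for b
  proof -
    obtain i where "i < n" "b = \<alpha> i" using b by auto
    thus ?thesis using arg_cong[OF eq, of "\<lambda>v :: 'a vec. v $ i"] by (simp add: coord_map_def)
  qed
  hence "(\<Sum>b\<in>\<alpha> ` {..<n}. ac_scale (?r x b) b) = (\<Sum>b\<in>\<alpha> ` {..<n}. ac_scale (?r y b) b)"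
    by (intro sum.cong) auto
  thus "x = y" using assms by (simp add: ac.sum_representation_eq[OF basis(1)] basis(2))
qed simp

lemma coord_bij: "bij_betw \<phi> E (carrier_vec n)"
proof -
  have inj: "inj_on \<phi> E" by (rule inj_onI) (simp add: coord_eq_iff)
  hence "card (\<phi> ` E) = card (carrier_vec n :: 'a vec set)"
    by (simp add: card_image card_E card_carrier_vec)
  hence "\<phi> ` E = carrier_vec n" by (intro card_subset_eq) auto
  thus ?thesis using inj by (simp add: bij_betw_def)
qed

lemma finite_F [simp]: "finite F" and card_F: "card F = card E ^ l"
  by (auto simp: card_PiE_dflt)

lemma F_ne: "F \<noteq> {}"
  using card_E by (auto simp: PiE_dflt_empty_iff)

lemma linear_code_pclp:
  assumes f: "f \<in> F"
  shows "linear_code n (pclp_code f)"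
proof -
  have E: "x \<in> V \<Longrightarrow> linearized_eval l f x \<in> E" for x
    using linearized_eval_in_E[OF f] V_subset_E by auto
  show ?thesis unfolding linear_code_iff
  proof (intro conjI ballI allI)
    show "pclp_code f \<subseteq> carrier_vec n" by (auto simp: pclp_code_def)
    have "\<phi> (linearized_eval l f 0) = 0\<^sub>v n" by (simp add: coord_zero)
    thus "0\<^sub>v n \<in> pclp_code f" unfolding pclp_code_def
      using ac.subspace_0[OF subspace_V] by (metis imageI)
    fix x c assume "x \<in> pclp_code f"
    then obtain x' where x: "x' \<in> V" "x = \<phi> (linearized_eval l f x')" by (auto simp: pclp_code_def)
    have "c \<cdot>\<^sub>v x = \<phi> (linearized_eval l f (ac_scale c x'))"
      using x E by (simp add: linearized_eval_scale coord_scale)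
    thus "c \<cdot>\<^sub>v x \<in> pclp_code f" unfolding pclp_code_def
      using ac.subspace_scale[OF subspace_V x(1)] by blast
    fix y assume "y \<in> pclp_code f"
    then obtain y' where y: "y' \<in> V" "y = \<phi> (linearized_eval l f y')" by (auto simp: pclp_code_def)
    have "x + y = \<phi> (linearized_eval l f (x' + y'))"
      using x y E by (simp add: linearized_eval_add coord_add)
    thus "x + y \<in> pclp_code f" unfolding pclp_code_def
      using ac.subspace_add[OF subspace_V x(1) y(1)] by blast
  qed
qed

text \<open>A product of uniform distributions is uniform on \<open>F\<close>, so every probability
  bound reduces to counting the bad coefficient families.\<close>

lemma prob_PCLP_ge:
  fixes b :: real
  assumes "real (card {f \<in> F. pclp_code f \<notin> A}) \<le> b * card F"
  shows "1 - b \<le> measure_pmf.prob (PCLP n l V \<alpha>) A"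
proof -
  have "PCLP n l V \<alpha> = map_pmf pclp_code (pmf_of_set F)"
    unfolding PCLP_def pclp_code_def
    by (subst Pi_pmf_of_set) (use card_E in auto)
  hence "measure_pmf.prob (PCLP n l V \<alpha>) (- A) = card (F \<inter> pclp_code -` (- A)) / card F"
    using F_ne by (simp add: measure_pmf_of_set)
  also have "F \<inter> pclp_code -` (- A) = {f \<in> F. pclp_code f \<notin> A}" by auto
  also have "real (card {f \<in> F. pclp_code f \<notin> A}) / card F \<le> b"
    using assms F_ne by (simp add: divide_le_eq card_gt_0_iff)
  finally show ?thesis
    using measure_pmf.prob_compl[of A "PCLP n l V \<alpha>"] by (simp add: Compl_eq_Diff_UNIV)
qed

text \<open>The basis identifies F_q^k with \<open>V\<close>; if \<open>f\<close> has trivial kernel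
  on \<open>V\<close>, following this with \<open>f\<close> and \<open>\<phi>\<close> is a linear
  bijection onto the code.\<close>

lemma code_dim_pclp:
  assumes f: "f \<in> F" and inj: "\<And>v. v \<in> V \<Longrightarrow> linearized_eval l f v = 0 \<Longrightarrow> v = 0"
  shows "code_dim n (pclp_code f) = k"
proof -
  let ?comb = "\<lambda>x :: 'a vec. \<Sum>i<k. ac_scale (x $ i) (\<alpha> i)"
  let ?T = "\<lambda>x. \<phi> (linearized_eval l f (?comb x))"
  have comb: "?comb x \<in> V" for x
    unfolding V_def by (intro ac.span_sum ac.span_scale ac.span_base) auto
  have E: "v \<in> V \<Longrightarrow> linearized_eval l f v \<in> E" for v
    using linearized_eval_in_E[OF f] V_subset_E by auto
  have comb_add: "?comb (x + y) = ?comb x + ?comb y" if "x \<in> carrier_vec k" "y \<in> carrier_vec k" for x y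
    using that by (simp add: ac.scale_left_distrib sum.distrib)
  have comb_scale: "?comb (c \<cdot>\<^sub>v x) = ac_scale c (?comb x)" if "x \<in> carrier_vec k" for c x
    using that by (simp add: ac.scale_sum_right)
  have "inj_on ?T (carrier_vec k)"
  proof (rule inj_onI)
    fix x y :: "'a vec" assume xy: "x \<in> carrier_vec k" "y \<in> carrier_vec k" "?T x = ?T y"
    have "linearized_eval l f (?comb x) = linearized_eval l f (?comb y)"
      using xy(3) coord_eq_iff[OF E[OF comb] E[OF comb]] by blast
    hence "linearized_eval l f (?comb x - ?comb y) = 0"
      using linearized_eval_add[of l f "?comb x - ?comb y" "?comb y"] by simp
    hence "?comb x - ?comb y = 0"
      using inj ac.subspace_diff[OF subspace_V comb comb] by blast
    hence 0: "(\<Sum>i<k. ac_scale (x $ i - y $ i) (\<alpha> i)) = 0"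
      by (simp add: ac.scale_left_diff_distrib sum_subtractf)
    have injk: "inj_on \<alpha> {..<k}" using k by (auto intro: inj_on_subset[OF inj_\<alpha>])
    \<comment> \<open>\<open>independentD\<close> expects coefficients indexed by basis elements, so
      the index of \<open>b\<close> is recovered by inverting \<open>\<alpha>\<close>.\<close>
    let ?u = "\<lambda>b. x $ (the_inv_into {..<k} \<alpha> b) - y $ (the_inv_into {..<k} \<alpha> b)"
    have "(\<Sum>b\<in>\<alpha> ` {..<k}. ac_scale (?u b) b) = 0"
      using 0 by (subst sum.reindex[OF injk]) (simp add: the_inv_into_f_f[OF injk])
    moreover have "ac.independent (\<alpha> ` {..<k})"
      by (rule ac.independent_mono[OF basis(1)]) (use k in auto)
    ultimately have "?u (\<alpha> i) = 0" if "i < k" for i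
      using ac.independentD[of "\<alpha> ` {..<k}" "\<alpha> ` {..<k}" ?u "\<alpha> i"] that by blast
    hence "x $ i = y $ i" if "i < k" for i
      using that by (simp add: the_inv_into_f_f[OF injk])
    thus "x = y" using xy by (intro eq_vecI) auto
  qed
  moreover have "?T ` carrier_vec k = pclp_code f"
  proof -
    have "?comb ` carrier_vec k = V"
    proof (intro equalityI subsetI)
      fix v assume "v \<in> V"
      then obtain u where u: "v = (\<Sum>b\<in>\<alpha> ` {..<k}. ac_scale (u b) b)"
        unfolding V_def by (subst (asm) ac.span_finite) auto
      have "v = (\<Sum>i<k. ac_scale (u (\<alpha> i)) (\<alpha> i))"
        unfolding u using k by (subst sum.reindex) (auto intro: inj_on_subset[OF inj_\<alpha>])
      hence "v = ?comb (vec k (\<lambda>i. u (\<alpha> i)))" by simp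
      thus "v \<in> ?comb ` carrier_vec k" by (rule image_eqI) simp
    qed (use comb in auto)
    thus ?thesis unfolding pclp_code_def by (metis image_image)
  qed
  ultimately have "bij_betw ?T (carrier_vec k) (pclp_code f)" by (simp add: bij_betw_def)
  thus ?thesis
  proof (rule code_dim_eqI[OF linear_code_pclp[OF f]])
    fix x y :: "'a vec" assume "x \<in> carrier_vec k" "y \<in> carrier_vec k"
    thus "?T (x + y) = ?T x + ?T y"
      by (simp only: comb_add linearized_eval_add coord_add E comb)
  next
    fix c and x :: "'a vec" assume "x \<in> carrier_vec k"
    thus "?T (c \<cdot>\<^sub>v x) = c \<cdot>\<^sub>v ?T x"
      by (simp only: comb_scale linearized_eval_scale coord_scale E comb)
  qed
qed

text \<open>Union bound over the fewer than q^k nonzero points of \<open>V\<close>; each is a single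
  independent vector, so interpolation bounds the families vanishing there by a q^(-n) share of
  \<open>F\<close>.\<close>

lemma card_dim_defect_le: "card {f \<in> F. code_dim n (pclp_code f) \<noteq> k} * CARD('a) ^ (n - k) \<le> card F"
proof -
  have "{f \<in> F. code_dim n (pclp_code f) \<noteq> k} \<subseteq> (\<Union>v\<in>V - {0}. {f \<in> F. linearized_eval l f v = 0})"
    using code_dim_pclp by blast
  hence "card {f \<in> F. code_dim n (pclp_code f) \<noteq> k} \<le> card (\<Union>v\<in>V - {0}. {f \<in> F. linearized_eval l f v = 0})"
    by (intro card_mono) auto
  also have "\<dots> \<le> (\<Sum>v\<in>V - {0}. card {f \<in> F. linearized_eval l f v = 0})"
    by (rule card_UN_le) simp
  also have "\<dots> \<le> (\<Sum>v\<in>V - {0}. card E ^ (l - 1))"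
  proof (rule sum_mono)
    fix v assume "v \<in> V - {0}"
    hence "ac.independent {v}" by simp
    from card_linearized_interpolants_le[OF _ this, of l E "\<lambda>_. 0"] l
    show "card {f \<in> F. linearized_eval l f v = 0} \<le> card E ^ (l - 1)" by simp
  qed
  also have "\<dots> \<le> CARD('a) ^ k * card E ^ (l - 1)"
    using card_Diff1_le[of V 0] by (simp add: card_V)
  finally have "card {f \<in> F. code_dim n (pclp_code f) \<noteq> k} * CARD('a) ^ (n - k)
      \<le> CARD('a) ^ k * card E ^ (l - 1) * CARD('a) ^ (n - k)"
    by (rule mult_le_mono1)
  also have "\<dots> = CARD('a) ^ (k + (n - k)) * card E ^ (l - 1)" by (simp add: power_add mult_ac)
  also have "\<dots> = card F" using k l by (simp add: card_F card_E flip: power_Suc)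
  finally show ?thesis .
qed

text \<open>The pairing of \<open>f\<close> and \<open>v\<close> is \<phi>(f(v)) \<bullet> y, and
  \<open>y\<close> is in the dual code iff \<open>f\<close> annihilates \<open>V\<close> under it.
  Nondegeneracy in \<open>v\<close> comes from varying \<open>f 0\<close>, so
  \<open>card_annihilator\<close> yields an exact count.\<close>

lemma card_dual_contains:
  assumes y: "y \<in> carrier_vec n" "y \<noteq> 0\<^sub>v n"
  shows "card {f \<in> F. y \<in> dual_code n (pclp_code f)} * CARD('a) ^ k = card F"
proof -
  let ?L = "\<lambda>x. \<phi> x \<bullet> y"
  have L_add: "?L (x + z) = ?L x + ?L z" if "x \<in> E" "z \<in> E" for x z
    using that y by (simp add: coord_add add_scalar_prod_distrib[of _ n])
  have L_scale: "?L (ac_scale c x) = c * ?L x" if "x \<in> E" for x c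
    using that y by (simp add: coord_scale)
  have evE: "linearized_eval l f v \<in> E" if "f \<in> F" "v \<in> V" for f v
    using that linearized_eval_in_E V_subset_E by auto
  obtain i where i: "i < n" "y $ i \<noteq> 0" using y by (metis carrier_vecD eq_vecI index_zero_vec)
  obtain w where w: "w \<in> E" "\<phi> w = (1 / y $ i) \<cdot>\<^sub>v unit_vec n i"
  proof -
    have "(1 / y $ i) \<cdot>\<^sub>v unit_vec n i \<in> \<phi> ` E" using coord_bij by (simp add: bij_betw_def)
    thus thesis by (elim imageE) (metis that)
  qed
  have Lw: "?L w = 1" using w i y by simp
  have "card {f \<in> F. \<forall>v\<in>V. ?L (linearized_eval l f v) = 0} * card V = card F"
  proof (rule card_annihilator[where z = 0])
    fix v assume v: "v \<in> V" "v \<noteq> 0"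
    have vE: "v \<in> E" using v V_subset_E by auto
    \<comment> \<open>Adding c a to \<open>f 0\<close> changes f(v) by c w, and \<open>w\<close> was
      chosen with functional value 1, so the pairing shifts by c.\<close>
    define a where "a = w / v"
    have a: "a \<in> E" "a * v = w" using E_divide[OF w(1) vE] v by (auto simp: a_def)
    have caE: "ac_scale c a \<in> E" for c using ac.subspace_scale[OF subspace_E a(1)] .
    show "CARD('a) * card {f \<in> F. ?L (linearized_eval l f v) = 0} = card F"
    proof (rule card_zeros_of_translatable[where t = "\<lambda>c f. f(0 := f 0 + ac_scale c a)"])
      fix c f assume f: "f \<in> F"
      have "f 0 \<in> E" using f l by (auto simp: PiE_dflt_def)
      thus "f(0 := f 0 + ac_scale c a) \<in> F"
        using f l ac.subspace_add[OF subspace_E _ caE] by (auto simp: PiE_dflt_def)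
      have "ac_scale c a * v = ac_scale c w" using a(2) by (simp add: ac_scale_def mult.assoc)
      thus "?L (linearized_eval l (f(0 := f 0 + ac_scale c a)) v) = ?L (linearized_eval l f v) + c"
        using l evE[OF f v(1)] ac.subspace_scale[OF subspace_E w(1)]
        by (simp add: linearized_eval_upd_0 L_add L_scale[OF w(1)] Lw)
      show "(f(0 := f 0 + ac_scale c a))(0 := (f(0 := f 0 + ac_scale c a)) 0 + ac_scale (- c) a) = f"
        by (simp add: add.assoc)
    qed simp
  next
    fix f assume f: "f \<in> F" and ex: "\<exists>v\<in>V. ?L (linearized_eval l f v) \<noteq> 0"
    then obtain v where v: "v \<in> V" "?L (linearized_eval l f v) \<noteq> 0" by auto
    define u where "u = ac_scale (1 / ?L (linearized_eval l f v)) v"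
    have u: "u \<in> V" "?L (linearized_eval l f u) = 1"
      using v ac.subspace_scale[OF subspace_V v(1)] evE[OF f v(1)]
      by (auto simp: u_def linearized_eval_scale L_scale)
    show "CARD('a) * card {v \<in> V. ?L (linearized_eval l f v) = 0} = card V"
    proof (rule card_zeros_of_translatable[where t = "\<lambda>c x. x + ac_scale c u"])
      fix c x assume x: "x \<in> V"
      have cu: "ac_scale c u \<in> V" by (rule ac.subspace_scale[OF subspace_V u(1)])
      show "x + ac_scale c u \<in> V" by (rule ac.subspace_add[OF subspace_V x cu])
      show "?L (linearized_eval l f (x + ac_scale c u)) = ?L (linearized_eval l f x) + c"
        using evE[OF f x] evE[OF f u(1)] ac.subspace_scale[OF subspace_E evE[OF f u(1)]] u(2)
        by (simp add: linearized_eval_add linearized_eval_scale L_add L_scale)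
      show "x + ac_scale c u + ac_scale (- c) u = x" by (simp add: add.assoc)
    qed simp
  qed (use ac.subspace_0[OF subspace_V] y in \<open>auto simp: coord_zero\<close>)
  moreover have "y \<in> dual_code n (pclp_code f) \<longleftrightarrow> (\<forall>v\<in>V. ?L (linearized_eval l f v) = 0)" for f
    using y by (simp add: dual_code_def pclp_code_def)
  ultimately show ?thesis by (simp add: card_V)
qed

text \<open>
  A subspace \<open>W\<close> of a PCLP code is determined by a section over a basis of \<open>W\<close>, and the
  values of such a section are linearly independent, so that Moore interpolation applies to each
  of the at most \<open>card V ^ dim W\<close> sections.
\<close>

lemma card_pclp_contains_le:
  assumes W: "linear_code n W" and cardW: "card W \<le> CARD('a) ^ l"
  shows "card {f \<in> F. W \<subseteq> pclp_code f} * card W ^ (n - k) \<le> card F"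
proof -
  note W' = W[unfolded linear_code_iff]
  define U where "U = {x \<in> E. \<phi> x \<in> W}"
  have subU: "ac.subspace U"
    using W' ac.subspace_0[OF subspace_E] ac.subspace_add[OF subspace_E] ac.subspace_scale[OF subspace_E]
    by (auto simp: U_def ac.subspace_def coord_zero coord_add coord_scale)
  have bijU: "bij_betw \<phi> U W"
  proof -
    have "\<phi> ` U = W"
    proof (intro equalityI subsetI)
      fix y assume y: "y \<in> W"
      hence "y \<in> \<phi> ` E" using W' coord_bij by (auto simp: bij_betw_def)
      then obtain x where "x \<in> E" "y = \<phi> x" by (rule imageE)
      thus "y \<in> \<phi> ` U" using y by (auto simp: U_def)
    qed (auto simp: U_def)
    thus ?thesis using coord_bij by (auto simp: bij_betw_def U_def intro: inj_on_subset)
  qed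
  obtain B where B: "B \<subseteq> U" "ac.independent B" "U \<subseteq> ac.span B" using ac.basis_exists by metis
  have spanB: "ac.span B = U" by (rule ac.span_subspace[OF B(1,3) subU])
  have BE: "B \<subseteq> E" using B(1) by (auto simp: U_def)
  have finB: "finite B" using finite_subset[OF BE] by simp
  let ?e = "card B"
  have W_card: "card W = CARD('a) ^ ?e"
    using ac_card_span(2)[OF finB B(2)] bij_betw_same_card[OF bijU] spanB by simp
  hence el: "?e \<le> l" using cardW card_field_gt_1[where ?'a = 'a] by (simp add: power_increasing_iff)
  \<comment> \<open>These are the candidate sections: for each element b of the basis of
    \<open>W\<close>, pulled back to \<open>E\<close>, a point of \<open>V\<close> that
    \<open>f\<close> should send to b.\<close>
  define S where "S = {s \<in> B \<rightarrow>\<^sub>E V. inj_on s B \<and> ac.independent (s ` B)}"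
  have finBV: "finite (B \<rightarrow>\<^sub>E V)" using finB by (intro finite_PiE) auto
  have finS: "finite S" unfolding S_def using finBV by simp
  have cardS: "card S \<le> card V ^ ?e"
    using card_mono[OF finBV, of S] finB by (simp add: S_def card_PiE)
  have cover: "{f \<in> F. W \<subseteq> pclp_code f} \<subseteq> (\<Union>s\<in>S. {f \<in> F. \<forall>v\<in>s ` B. linearized_eval l f v = the_inv_into B s v})"
  proof
    fix f assume "f \<in> {f \<in> F. W \<subseteq> pclp_code f}"
    hence f: "f \<in> F" "W \<subseteq> pclp_code f" by auto
    have "\<exists>v\<in>V. linearized_eval l f v = b" if b: "b \<in> B" for b
    proof -
      have "\<phi> b \<in> pclp_code f" using f(2) B(1) b by (auto simp: U_def)
      then obtain v where v: "v \<in> V" "\<phi> b = \<phi> (linearized_eval l f v)" by (auto simp: pclp_code_def)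
      have "linearized_eval l f v = b"
        using v b BE linearized_eval_in_E[OF f(1), of v] V_subset_E
        by (subst coord_eq_iff[symmetric]) auto
      thus ?thesis using v by auto
    qed
    then obtain s where s: "\<And>b. b \<in> B \<Longrightarrow> s b \<in> V" "\<And>b. b \<in> B \<Longrightarrow> linearized_eval l f (s b) = b" by metis
    have inj: "inj_on s B" by (rule inj_onI) (metis s(2))
    have ind: "ac.independent (s ` B)"
    \<comment> \<open>Applying \<open>f\<close> to a relation among the values s(b) gives the same
      relation among the independent elements b.\<close>
    proof (rule ac.independent_if_scalars_zero)
      show "finite (s ` B)" using finB by simp
      fix c x assume 0: "(\<Sum>x\<in>s ` B. ac_scale (c x) x) = 0" and x: "x \<in> s ` B"
      have "(\<Sum>x\<in>s ` B. ac_scale (c x) (linearized_eval l f x)) = linearized_eval l f 0"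
        unfolding 0[symmetric] by (rule linearized_eval_sum[symmetric])
      hence "(\<Sum>b\<in>B. ac_scale (c (s b)) b) = 0"
        using s(2) by (simp add: sum.reindex[OF inj])
      hence "c (s b) = 0" if "b \<in> B" for b
        using ac.independentD[OF B(2) finB order.refl, of "\<lambda>b. c (s b)" b] that by blast
      thus "c x = 0" using x by auto
    qed
    have im: "restrict s B ` B = s ` B" by auto
    have injr: "inj_on (restrict s B) B" using inj by (simp add: inj_on_def)
    have "restrict s B \<in> S" unfolding S_def using s(1) ind injr im by auto
    moreover have "linearized_eval l f v = the_inv_into B (restrict s B) v" if "v \<in> restrict s B ` B" for v
    proof -
      obtain b where b: "b \<in> B" "v = restrict s B b" using \<open>v \<in> restrict s B ` B\<close> by (rule imageE)
      show ?thesis unfolding b(2) the_inv_into_f_f[OF injr b(1)] using s(2) b(1) by simp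
    qed
    ultimately show "f \<in> (\<Union>s\<in>S. {f \<in> F. \<forall>v\<in>s ` B. linearized_eval l f v = the_inv_into B s v})"
      using f(1) by blast
  qed
  have "card {f \<in> F. W \<subseteq> pclp_code f}
      \<le> card (\<Union>s\<in>S. {f \<in> F. \<forall>v\<in>s ` B. linearized_eval l f v = the_inv_into B s v})"
    by (intro card_mono cover finite_UN_I finS) simp
  also have "\<dots> \<le> (\<Sum>s\<in>S. card {f \<in> F. \<forall>v\<in>s ` B. linearized_eval l f v = the_inv_into B s v})"
    by (rule card_UN_le[OF finS])
  also have "\<dots> \<le> (\<Sum>s\<in>S. card E ^ (l - ?e))"
  proof (rule sum_mono)
    fix s assume s: "s \<in> S"
    hence "card (s ` B) = ?e" by (simp add: S_def card_image)
    thus "card {f \<in> F. \<forall>v\<in>s ` B. linearized_eval l f v = the_inv_into B s v} \<le> card E ^ (l - ?e)"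
      using card_linearized_interpolants_le[of "s ` B" l E "the_inv_into B s"] s finB el
      by (simp add: S_def)
  qed
  also have "\<dots> \<le> card V ^ ?e * card E ^ (l - ?e)" using cardS by simp
  finally have "card {f \<in> F. W \<subseteq> pclp_code f} * card W ^ (n - k)
      \<le> card V ^ ?e * card E ^ (l - ?e) * card W ^ (n - k)"
    by (rule mult_le_mono1)
  also have "\<dots> = CARD('a) ^ (k * ?e + n * (l - ?e) + ?e * (n - k))"
    by (simp add: card_V card_E W_card power_add power_mult)
  \<comment> \<open>The exponents come from the sections, the interpolants per section, and
    |W|^(n-k); the first and last add up to n e.\<close>
  also have "k * ?e + n * (l - ?e) + ?e * (n - k) = n * l"
  proof -
    have "k * ?e + ?e * (n - k) = n * ?e" using k(2) by (simp add: diff_mult_distrib2 mult.commute)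
    moreover have "n * ?e + n * (l - ?e) = n * l" using el by (simp flip: distrib_left)
    ultimately show ?thesis by linarith
  qed
  also have "CARD('a) ^ (n * l) = card F" by (simp add: card_F card_E power_mult)
  finally show ?thesis .
qed

end

section \<open>The entropy function and Hamming balls\<close>

text \<open>Only 0 needs a limit: the product is 0 there, which is also its limit from the
  right.\<close>

lemma continuous_on_mult_ln: "continuous_on {0..} (\<lambda>x::real. x * ln x)"
  unfolding continuous_on_eq_continuous_within
proof
  fix x :: real assume x: "x \<in> {0..}"
  show "continuous (at x within {0..}) (\<lambda>x. x * ln x)"
  proof (cases "x = 0")
    case True
    have "((\<lambda>x::real. x * ln x) \<longlongrightarrow> 0) (at_right 0)" by real_asymp
    thus ?thesis unfolding True continuous_within by (simp add: at_within_Ici_at_right)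
  next
    case False
    thus ?thesis using x by (intro continuous_intros) auto
  qed
qed

lemma qary_entropy_eq:
  assumes "0 \<le> x" "x \<le> 1"
  shows "qary_entropy q x = (x * ln (real q - 1) - x * ln x - (1 - x) * ln (1 - x)) / ln q"
proof -
  have log: "y * log q (1 / y) = - (y * ln y) / ln q" if "0 \<le> y" for y :: real
    using that by (cases "y = 0") (simp_all add: log_def ln_div)
  have "qary_entropy q x = x * log q (real q - 1) + - (x * ln x) / ln q + - ((1 - x) * ln (1 - x)) / ln q"
    unfolding qary_entropy_def using log[of x] log[of "1 - x"] assms by linarith
  thus ?thesis by (simp add: log_def diff_divide_distrib)
qed

lemma continuous_on_qary_entropy:
  assumes "1 < q"
  shows "continuous_on {0..1} (qary_entropy q)"
proof -
  have "continuous_on {0..1} (\<lambda>x::real. x * ln x)"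
    by (rule continuous_on_subset[OF continuous_on_mult_ln]) auto
  moreover have "continuous_on {0..1} (\<lambda>x::real. (1 - x) * ln (1 - x))"
    by (rule continuous_on_compose2[OF continuous_on_mult_ln]) (auto intro!: continuous_intros)
  ultimately have "continuous_on {0..1} (\<lambda>x. (x * ln (real q - 1) - x * ln x - (1 - x) * ln (1 - x)) / ln q)"
    using assms
    by (intro continuous_on_divide continuous_on_diff continuous_on_mult_right continuous_on_const continuous_on_id)
      simp_all
  thus ?thesis by (rule continuous_on_eq) (simp add: qary_entropy_eq)
qed

text \<open>The derivative is log_q ((q-1)(1-z)/z), which is positive exactly when z < 1 - 1/q.
  Continuity takes care of the endpoints, where the formula need not be differentiable.\<close>

lemma qary_entropy_strict_mono:
  assumes q: "1 < q" and x: "0 \<le> x" and xy: "x < y" and y: "y \<le> 1 - 1 / real q"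
  shows "qary_entropy q x < qary_entropy q y"
proof -
  let ?g = "\<lambda>x. (x * ln (real q - 1) - x * ln x - (1 - x) * ln (1 - x)) / ln q"
  have "0 < 1 / real q" using q by simp
  hence y1: "y < 1" using y by linarith
  have "?g x < ?g y"
  proof (rule DERIV_pos_imp_increasing_open[OF xy])
    fix z assume z: "x < z" "z < y"
    let ?D = "(ln (real q - 1) - ln z + ln (1 - z)) / ln q"
    have z01: "0 < z" "z < 1" using z x y1 by auto
    have "z * q < real q - 1"
    proof -
      have "z < 1 - 1 / real q" using z y by simp
      hence "z * q < (1 - 1 / real q) * q" using q by (intro mult_strict_right_mono) auto
      thus ?thesis using q by (simp add: algebra_simps)
    qed
    hence "z < (real q - 1) * (1 - z)" by (simp add: algebra_simps)
    hence "ln z < ln ((real q - 1) * (1 - z))" using z01 by simp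
    also have "\<dots> = ln (real q - 1) + ln (1 - z)" using z01 q by (simp add: ln_mult)
    finally have "0 < ?D" using q by simp
    moreover have "(?g has_real_derivative ?D) (at z)"
    proof -
      have "((\<lambda>x. x * ln x) has_real_derivative (ln z + 1)) (at z)"
        using z01 by (auto intro!: derivative_eq_intros)
      moreover have "((\<lambda>x. (1 - x) * ln (1 - x)) has_real_derivative (- ln (1 - z) - 1)) (at z)"
        using z01 by (auto intro!: derivative_eq_intros)
      moreover have "((\<lambda>x. x * ln (real q - 1)) has_real_derivative ln (real q - 1)) (at z)"
        by (auto intro!: derivative_eq_intros)
      ultimately have "(?g has_real_derivative
          (ln (real q - 1) - (ln z + 1) - (- ln (1 - z) - 1)) / ln q) (at z)"
        by (intro DERIV_cdivide DERIV_diff)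
      thus ?thesis by (simp add: algebra_simps)
    qed
    ultimately show "\<exists>D. (?g has_real_derivative D) (at z) \<and> 0 < D" by blast
  next
    have "continuous_on {x..y} (qary_entropy q)"
      using x y1 by (intro continuous_on_subset[OF continuous_on_qary_entropy[OF q]]) auto
    thus "continuous_on {x..y} ?g"
      by (rule continuous_on_eq) (use x y1 in \<open>simp add: qary_entropy_eq\<close>)
  qed
  thus ?thesis using x xy y1 by (simp add: qary_entropy_eq)
qed

lemma qary_entropy_0: "qary_entropy q 0 = 0"
  by (simp add: qary_entropy_eq)

lemma qary_entropy_max:
  assumes "1 < q"
  shows "qary_entropy q (1 - 1 / real q) = 1"
proof -
  let ?x = "1 - 1 / real q"
  have "?x = (real q - 1) / q" using assms by (simp add: field_simps)
  hence "ln ?x = ln (real q - 1) - ln q" using assms by (simp add: ln_div)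
  moreover have "ln (1 - ?x) = - ln q" using assms by (simp add: ln_div)
  ultimately have ln: "ln ?x = ln (real q - 1) - ln q" "ln (1 - ?x) = - ln q" .
  have "qary_entropy q ?x = (?x * ln (real q - 1) - ?x * ln ?x - (1 - ?x) * ln (1 - ?x)) / ln q"
    by (rule qary_entropy_eq) (use assms in auto)
  also have "\<dots> = (?x * ln (real q - 1) - ?x * (ln (real q - 1) - ln q) - (1 - ?x) * - ln q) / ln q"
    by (simp only: ln)
  also have "\<dots> = 1" using assms by (simp add: field_simps)
  finally show ?thesis .
qed

text \<open>Strict monotonicity gives injectivity and the intermediate value theorem surjectivity
  onto [0, 1], so \<open>the_inv_into\<close> really inverts the entropy there.\<close>

lemma qary_entropy_inv:
  assumes q: "1 < q" and r: "0 \<le> r" "r \<le> 1"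
  shows "qary_entropy_inv q r \<in> {0..1 - 1 / real q}" "qary_entropy q (qary_entropy_inv q r) = r"
proof -
  let ?I = "{0..1 - 1 / real q}"
  have inj: "inj_on (qary_entropy q) ?I"
  proof (rule inj_onI)
    fix x y assume "x \<in> ?I" "y \<in> ?I" "qary_entropy q x = qary_entropy q y"
    thus "x = y"
      using qary_entropy_strict_mono[OF q, of x y] qary_entropy_strict_mono[OF q, of y x]
      by (cases x y rule: linorder_cases) auto
  qed
  have "\<exists>x. 0 \<le> x \<and> x \<le> 1 - 1 / real q \<and> qary_entropy q x = r"
  proof (rule IVT')
    show "continuous_on ?I (qary_entropy q)"
      by (rule continuous_on_subset[OF continuous_on_qary_entropy[OF q]]) auto
  qed (use r q in \<open>auto simp: qary_entropy_0 qary_entropy_max\<close>)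
  hence "r \<in> qary_entropy q ` ?I" by auto
  thus "qary_entropy_inv q r \<in> ?I" "qary_entropy q (qary_entropy_inv q r) = r"
    unfolding qary_entropy_inv_def
    using the_inv_into_into[OF inj _ order.refl] f_the_inv_into_f[OF inj] by blast+
qed

section \<open>Volume of Hamming balls\<close>

text \<open>The weight enumerator of the full space factors over coordinates: a zero entry
  contributes 1 and each of the q - 1 nonzero entries contributes t.\<close>

lemma sum_power_hamming_weight:
  fixes t :: real
  shows "(\<Sum>y\<in>(carrier_vec n :: 'a::{finite,zero} vec set). t ^ card {i. i < n \<and> y $ i \<noteq> 0})
    = (1 + (real CARD('a) - 1) * t) ^ n"
proof -
  let ?w = "\<lambda>c :: 'a. if c = 0 then 1 else t"
  have "(\<Sum>y\<in>(carrier_vec n :: 'a vec set). t ^ card {i. i < n \<and> y $ i \<noteq> 0})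
      = (\<Sum>f\<in>{..<n} \<rightarrow>\<^sub>E (UNIV :: 'a set). t ^ card {i. i < n \<and> vec n f $ i \<noteq> 0})"
    by (rule sum.reindex_bij_betw[symmetric, OF bij_betw_carrier_vec])
  also have "\<dots> = (\<Sum>f\<in>{..<n} \<rightarrow>\<^sub>E (UNIV :: 'a set). \<Prod>i<n. ?w (f i))"
  proof (rule sum.cong[OF refl])
    fix f :: "nat \<Rightarrow> 'a"
    have "{i. i < n \<and> vec n f $ i \<noteq> 0} = {..<n} \<inter> - {i. f i = 0}" by auto
    thus "t ^ card {i. i < n \<and> vec n f $ i \<noteq> 0} = (\<Prod>i<n. ?w (f i))"
      by (simp add: prod.If_cases)
  qed
  also have "\<dots> = (\<Prod>i<n. \<Sum>c\<in>UNIV. ?w c)"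
    by (rule prod_sum_PiE[symmetric]) auto
  also have "(\<Sum>c\<in>UNIV. ?w c) = 1 + (real CARD('a) - 1) * t"
    by (subst sum.remove[of _ 0]) (auto simp: sum.If_cases card_Diff_singleton of_nat_diff Suc_leI
        intro!: sum.cong)
  finally show ?thesis by simp
qed

text \<open>Chernoff's method: for 0 < t \<le> 1 a word of weight below d n satisfies t^weight \<ge>
  t^(d n), so the weight enumerator divided by t^(d n) bounds the ball. For d = 0 the strict
  inequality makes the ball empty.\<close>

lemma card_hamming_ball_le:
  fixes q :: nat
  assumes q_def: "q = CARD('a::finite_field)" and d: "0 \<le> d" "d \<le> 1 - 1 / real q"
  shows "real (card {y \<in> (carrier_vec n :: 'a::finite_field vec set). real (card {i. i < n \<and> y $ i \<noteq> 0}) < d * n})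
    \<le> q powr (n * qary_entropy q d)"
proof (cases "d = 0")
  case False
  let ?S = "{y \<in> (carrier_vec n :: 'a vec set). real (card {i. i < n \<and> y $ i \<noteq> 0}) < d * n}"
  have q: "1 < q" unfolding q_def by (rule card_field_gt_1)
  have d0: "0 < d" using d False by simp
  have "0 < 1 / real q" using q by simp
  hence d1: "d < 1" using d by linarith
  \<comment> \<open>This is the minimiser of (1 + (q-1) t)^n / t^(d n); the condition t \<le> 1
    amounts to d \<le> 1 - 1/q.\<close>
  define t where "t = d / ((real q - 1) * (1 - d))"
  have t0: "0 < t" unfolding t_def using d0 d1 q by simp
  have "d * q \<le> (1 - 1 / real q) * q" using d by (intro mult_right_mono) auto
  hence "d \<le> (real q - 1) * (1 - d)" using q by (simp add: algebra_simps)
  hence t1: "t \<le> 1" unfolding t_def using d1 q by simp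
  have "card ?S * t powr (d * n) = (\<Sum>y\<in>?S. t powr (d * n))" by simp
  also have "\<dots> \<le> (\<Sum>y\<in>?S. t ^ card {i. i < n \<and> y $ i \<noteq> 0})"
  proof (rule sum_mono)
    fix y assume "y \<in> ?S"
    hence "t powr (d * n) \<le> t powr real (card {i. i < n \<and> y $ i \<noteq> 0})"
      using t0 t1 by (intro powr_mono') auto
    thus "t powr (d * n) \<le> t ^ card {i. i < n \<and> y $ i \<noteq> 0}" using t0 by (simp add: powr_realpow)
  qed
  also have "\<dots> \<le> (\<Sum>y\<in>(carrier_vec n :: 'a vec set). t ^ card {i. i < n \<and> y $ i \<noteq> 0})"
    using t0 by (intro sum_mono2) auto
  also have "\<dots> = (1 + (real q - 1) * t) ^ n" unfolding q_def by (rule sum_power_hamming_weight)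
  also have "1 + (real q - 1) * t = 1 / (1 - d)"
  proof -
    have "(real q - 1) * t = d / (1 - d)" unfolding t_def using q by simp
    thus ?thesis using d1 by (simp add: field_simps)
  qed
  finally have "card ?S \<le> (1 / (1 - d)) ^ n / t powr (d * n)" using t0 by (subst pos_le_divide_eq) simp_all
  also have "\<dots> = exp (n * ln (1 / (1 - d)) - d * n * ln t)"
    using t0 d1 by (simp add: exp_diff powr_def exp_of_nat_mult)
  also have "n * ln (1 / (1 - d)) - d * n * ln t = n * (d * ln (real q - 1) - d * ln d - (1 - d) * ln (1 - d))"
  proof -
    have "ln t = ln d - (ln (real q - 1) + ln (1 - d))"
      unfolding t_def using d0 d1 q by (simp add: ln_div ln_mult)
    moreover have "ln (1 / (1 - d)) = - ln (1 - d)" using d1 by (simp add: ln_div)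
    ultimately show ?thesis by (simp only:) (simp add: algebra_simps)
  qed
  also have "exp \<dots> = q powr (n * qary_entropy q d)"
    using d0 d1 q by (simp add: powr_def qary_entropy_eq)
  finally show ?thesis .
qed simp

section \<open>Local properties, dual distance and rate of PCLP codes\<close>

text \<open>The q scalar multiples of a nonzero codeword are distinct. This later turns a saving in
  powers of an image size into one in powers of q.\<close>

lemma card_field_le_card_linear_code:
  assumes C: "linear_code n (C :: 'a::finite_field vec set)" and gt: "1 < card C"
  shows "CARD('a) \<le> card C"
proof -
  have "\<not> C \<subseteq> {0\<^sub>v n}" using gt card_mono[of "{0\<^sub>v n}" C] by auto
  then obtain w where w: "w \<in> C" "w \<noteq> 0\<^sub>v n" by blast
  have wc: "w \<in> carrier_vec n" using C w by (auto simp: linear_code_iff)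
  obtain i where i: "i < n" "w $ i \<noteq> 0" using w wc by (metis carrier_vecD eq_vecI index_zero_vec)
  show ?thesis
  proof (rule card_inj_on_le)
    show "inj (\<lambda>c. c \<cdot>\<^sub>v w)"
    proof (rule injI)
      fix c d assume "c \<cdot>\<^sub>v w = d \<cdot>\<^sub>v w"
      hence "(c \<cdot>\<^sub>v w) $ i = (d \<cdot>\<^sub>v w) $ i" by simp
      thus "c = d" using i wc by simp
    qed
    show "range (\<lambda>c. c \<cdot>\<^sub>v w) \<subseteq> C" using C w by (auto simp: linear_code_iff)
  qed (rule finite_linear_code[OF C])
qed

text \<open>The supremum runs over a finite set and is therefore attained; \<open>0 < r\<close>
  rules out the inserted value 0.\<close>

lemma threshold_rate_obtains:
  assumes "0 < r" "r \<le> threshold_rate n P"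
  obtains k' where "k' \<le> n" "r \<le> real k' / real n" "1 / 2 \<le> measure_pmf.prob (RLC n k') P"
proof -
  let ?S = "{real k / real n | k. k \<le> n \<and> measure_pmf.prob (RLC n k) P \<ge> 1 / 2}"
  have "?S \<subseteq> (\<lambda>k. real k / real n) ` {..n}" by auto
  hence fin: "finite (insert 0 ?S)" using finite_subset by blast
  have "threshold_rate n P = Max (insert 0 ?S)"
    unfolding threshold_rate_def by (rule cSup_eq_Max[OF fin]) simp
  hence "threshold_rate n P \<in> insert 0 ?S" using Max_in[OF fin] by simp
  thus thesis using assms that by auto
qed

text \<open>If no such \<open>D\<close> existed, the second moment bound would leave at most a
  quarter of the kernels avoiding the type, against the half that satisfies
  \<open>P\<close>.\<close>

lemma RLC_obtains_rare_restriction: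
  fixes P :: "'a::finite_field vec set set"
  assumes prob: "1 / 2 \<le> measure_pmf.prob (RLC n k') P" and n: "n > 0"
    and A: "A \<in> matrices_of_type n l \<tau>"
    and P: "\<And>C. linear_code n C \<Longrightarrow> C \<in> P \<Longrightarrow> \<forall>B\<in>matrices_of_type n l \<tau>. \<not> columns_in B C"
  obtains D where "linear_code l D" "1 < card ((\<lambda>x. A *\<^sub>v x) ` D)"
    "card (restrictions n l \<tau> D) < type_const CARD('a) l * card ((\<lambda>x. A *\<^sub>v x) ` D) ^ (n - k')"
proof -
  let ?\<Omega> = "carrier_mat (n - k') n :: 'a mat set"
  let ?S = "{H \<in> ?\<Omega>. \<forall>B\<in>matrices_of_type n l \<tau>. \<not> columns_in B (mat_kernel H)}"
  have ne: "?\<Omega> \<noteq> {}" using zero_carrier_mat by blast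
  have pos: "0 < real (card ?\<Omega>)" using ne by (simp add: card_gt_0_iff)
  have "1 / 2 \<le> real (card (?\<Omega> \<inter> mat_kernel -` P)) / card ?\<Omega>"
    using prob ne unfolding RLC_def by (simp add: measure_pmf_of_set)
  also have "\<dots> \<le> real (card ?S) / card ?\<Omega>"
    using P[OF linear_code_mat_kernel] pos
    by (intro divide_right_mono of_nat_mono card_mono) auto
  finally have "\<not> real (card ?S) \<le> 1 / 4 * card ?\<Omega>" using pos by (simp add: field_simps)
  hence "\<exists>D. linear_code l D \<and> 1 < card ((\<lambda>x. A *\<^sub>v x) ` D) \<and>
      \<not> type_const CARD('a) l * card ((\<lambda>x. A *\<^sub>v x) ` D) ^ (n - k') \<le> card (restrictions n l \<tau> D)"
    using card_kernels_avoiding_type_le[OF A n, of "n - k'"] by blast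
  thus thesis using that by (auto simp: not_le)
qed

context pclp
begin

lemma n_pos: "0 < n"
  using k by simp

text \<open>First moment over restrictions to the rare \<open>D\<close> instead of over matrices.
  There are fewer than K N^(n-k') restrictions, each has its image of size N in the code with
  probability at most N^(-(n-k)), and the product is K N^(-(k'-k)) with N \<ge> q.\<close>

lemma card_contains_type_le:
  assumes prob: "1 / 2 \<le> measure_pmf.prob (RLC n k') P" and k': "k \<le> k'" "k' \<le> n"
    and P: "\<And>C. linear_code n C \<Longrightarrow> C \<in> P \<Longrightarrow> \<forall>B\<in>matrices_of_type n l \<tau>. \<not> columns_in B C"
  shows "card {f \<in> F. \<exists>B\<in>matrices_of_type n l \<tau>. columns_in B (pclp_code f)} * CARD('a) ^ (k' - k)
    \<le> type_const CARD('a) l * card F"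
proof (cases "matrices_of_type n l \<tau> = ({} :: 'a mat set)")
  case False
  then obtain A :: "'a mat" where A: "A \<in> matrices_of_type n l \<tau>" by auto
  let ?K = "type_const CARD('a) l"
  obtain D where D: "linear_code l D" and N1: "1 < card ((\<lambda>x. A *\<^sub>v x) ` D)"
    and rare: "card (restrictions n l \<tau> D) < ?K * card ((\<lambda>x. A *\<^sub>v x) ` D) ^ (n - k')"
    using RLC_obtains_rare_restriction[OF prob n_pos A P] by metis
  define N where "N = card ((\<lambda>x. A *\<^sub>v x) ` D)"
  have finD: "finite D" by (rule finite_linear_code[OF D])
  have carr: "B \<in> carrier_mat n l" if "B \<in> matrices_of_type n l \<tau>" for B
    using that by (simp add: matrices_of_type_def)
  have qN: "CARD('a) \<le> N"
    unfolding N_def by (rule card_field_le_card_linear_code[OF linear_code_image_mat[OF carr[OF A] D] N1])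
  have Npos: "0 < N" using N1 by (simp add: N_def)
  have nk: "n - k = (k' - k) + (n - k')" using k' by simp
  let ?X = "{f \<in> F. \<exists>B\<in>matrices_of_type n l \<tau>. columns_in B (pclp_code f)}"
  have finR: "finite (restrictions n l \<tau> D)" by (simp add: restrictions_def)
  have "?X \<subseteq> (\<Union>r\<in>restrictions n l \<tau> D. {f \<in> F. r ` D \<subseteq> pclp_code f})"
  proof
    fix f assume "f \<in> ?X"
    then obtain B where B: "f \<in> F" "B \<in> matrices_of_type n l \<tau>" "columns_in B (pclp_code f)" by auto
    have "(\<lambda>x. B *\<^sub>v x) ` carrier_vec l \<subseteq> pclp_code f"
      using columns_in_iff[OF carr[OF B(2)] linear_code_pclp[OF B(1)]] B(3) by blast
    moreover have "D \<subseteq> carrier_vec l" using D by (simp add: linear_code_iff)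
    ultimately have "restrict (\<lambda>x. B *\<^sub>v x) D ` D \<subseteq> pclp_code f" by auto
    moreover have "restrict (\<lambda>x. B *\<^sub>v x) D \<in> restrictions n l \<tau> D"
      using B(2) unfolding restrictions_def by blast
    ultimately show "f \<in> (\<Union>r\<in>restrictions n l \<tau> D. {f \<in> F. r ` D \<subseteq> pclp_code f})"
      using B(1) by blast
  qed
  hence "card ?X \<le> card (\<Union>r\<in>restrictions n l \<tau> D. {f \<in> F. r ` D \<subseteq> pclp_code f})"
    by (intro card_mono finite_UN_I finR) simp
  also have "\<dots> \<le> (\<Sum>r\<in>restrictions n l \<tau> D. card {f \<in> F. r ` D \<subseteq> pclp_code f})"
    by (rule card_UN_le[OF finR])
  finally have "card ?X * N ^ (n - k) \<le> (\<Sum>r\<in>restrictions n l \<tau> D. card {f \<in> F. r ` D \<subseteq> pclp_code f} * N ^ (n - k))"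
    by (simp flip: sum_distrib_right)
  also have "\<dots> \<le> (\<Sum>r\<in>restrictions n l \<tau> D. card F)"
  proof (rule sum_mono)
    fix r assume "r \<in> restrictions n l \<tau> D"
    then obtain B where B: "B \<in> matrices_of_type n l \<tau>" "r = restrict (\<lambda>x. B *\<^sub>v x) D"
      by (auto simp: restrictions_def)
    have im: "r ` D = (\<lambda>x. B *\<^sub>v x) ` D" unfolding B(2) by auto
    have cardN: "card (r ` D) = N"
      unfolding im N_def by (rule card_image_matrices_of_type_eq[OF A B(1) n_pos finD])
    have "card (r ` D) \<le> card D" by (rule card_image_le[OF finD])
    also have "\<dots> \<le> card (carrier_vec l :: 'a vec set)"
      using D by (intro card_mono) (auto simp: linear_code_iff)
    finally have "card (r ` D) \<le> CARD('a) ^ l" by (simp add: card_carrier_vec)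
    from card_pclp_contains_le[OF _ this]
    show "card {f \<in> F. r ` D \<subseteq> pclp_code f} * N ^ (n - k) \<le> card F"
      using linear_code_image_mat[OF carr[OF B(1)] D] by (simp add: im flip: cardN)
  qed
  also have "\<dots> \<le> ?K * N ^ (n - k') * card F"
    using rare by (simp add: N_def)
  also have "?K * N ^ (n - k') * card F = ?K * card F * N ^ (n - k')" by simp
  finally have "card ?X * N ^ (k' - k) * N ^ (n - k') \<le> ?K * card F * N ^ (n - k')"
    unfolding nk by (simp only: power_add mult.assoc)
  hence "card ?X * N ^ (k' - k) \<le> ?K * card F" using Npos by simp
  moreover have "card ?X * CARD('a) ^ (k' - k) \<le> card ?X * N ^ (k' - k)"
    by (intro mult_le_mono2 power_mono qN) simp
  ultimately show ?thesis by linarith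
qed simp

text \<open>Union bound over the forbidden types, using a rate k'/n \<ge> k/n + e at which random
  linear codes satisfy \<open>P\<close> with probability at least 1/2. Since k' \<le> n, such a rate
  also forces the second claim, which later controls the rate defect.\<close>

lemma card_not_local_property_le:
  fixes e :: real
  assumes P: "local_property n l P" and e: "0 < e" and R: "real k / real n \<le> threshold_rate n P - e"
  shows "real (card {f \<in> F. pclp_code f \<notin> P})
    \<le> real ((n + 1) ^ (CARD('a) ^ l) * type_const CARD('a) l) * CARD('a) powr (- (n * e)) * card F"
    and "e \<le> 1 - real k / real n"
proof -
  have "0 < real k / real n + e" using e by (simp add: add_nonneg_pos)
  then obtain k' where k': "k' \<le> n" "real k / real n + e \<le> real k' / real n"
    "1 / 2 \<le> measure_pmf.prob (RLC n k') P"
    using threshold_rate_obtains[of "real k / real n + e" n P] R by auto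
  have "real k' / real n \<le> 1" using k'(1) n_pos by (simp add: divide_le_eq)
  thus "e \<le> 1 - real k / real n" using k'(2) by linarith
  have "(real k / real n + e) * n \<le> real k' / real n * n" using k'(2) by (rule mult_right_mono) simp
  hence ke: "real k + n * e \<le> real k'" using n_pos by (simp add: distrib_right mult.commute[of e])
  moreover have "0 < n * e" using e n_pos by simp
  ultimately have "real k \<le> real k'" by linarith
  hence kk': "k \<le> k'" by simp
  let ?q = "CARD('a)" and ?K = "type_const CARD('a) l"
  have q: "1 < ?q" by (rule card_field_gt_1)
  obtain T :: "'a vec pmf set" where T: "\<And>C. linear_code n C \<Longrightarrow>
      C \<in> P \<longleftrightarrow> (\<forall>\<tau>\<in>T. \<forall>A\<in>matrices_of_type n l \<tau>. \<not> columns_in A C)"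
    using P unfolding local_property_def by metis
  \<comment> \<open>Distributions that no n by l matrix realises impose no condition, so the
    polynomial bound on the number of types replaces the size of \<open>T\<close>.\<close>
  define T' where "T' = T \<inter> row_distribution ` (carrier_mat n l :: 'a mat set)"
  let ?X = "\<lambda>\<tau>. {f \<in> F. \<exists>B\<in>matrices_of_type n l \<tau>. columns_in B (pclp_code f)}"
  have finT': "finite T'" unfolding T'_def using card_row_distributions_le(1)[OF n_pos] by blast
  have "card T' \<le> card (row_distribution ` (carrier_mat n l :: 'a mat set))"
    unfolding T'_def by (intro card_mono card_row_distributions_le(1)[OF n_pos]) auto
  also have "\<dots> \<le> (n + 1) ^ (?q ^ l)" by (rule card_row_distributions_le(2)[OF n_pos])
  finally have cardT': "real (card T') \<le> real ((n + 1) ^ (?q ^ l))" by (simp only: of_nat_le_iff)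
  have "{f \<in> F. pclp_code f \<notin> P} \<subseteq> (\<Union>\<tau>\<in>T'. ?X \<tau>)"
  proof
    fix f assume "f \<in> {f \<in> F. pclp_code f \<notin> P}"
    hence f: "f \<in> F" "pclp_code f \<notin> P" by auto
    then obtain \<tau> A where A: "\<tau> \<in> T" "A \<in> matrices_of_type n l \<tau>" "columns_in A (pclp_code f)"
      using T[OF linear_code_pclp[OF f(1)]] by auto
    have "\<tau> \<in> T'" using A(1,2) by (auto simp: T'_def matrices_of_type_def)
    thus "f \<in> (\<Union>\<tau>\<in>T'. ?X \<tau>)" using f(1) A by blast
  qed
  hence "card {f \<in> F. pclp_code f \<notin> P} \<le> card (\<Union>\<tau>\<in>T'. ?X \<tau>)"
    by (intro card_mono finite_UN_I finT') simp
  also have "\<dots> \<le> (\<Sum>\<tau>\<in>T'. card (?X \<tau>))" by (rule card_UN_le[OF finT'])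
  finally have "real (card {f \<in> F. pclp_code f \<notin> P}) \<le> (\<Sum>\<tau>\<in>T'. real (card (?X \<tau>)))"
    by (simp only: of_nat_le_iff flip: of_nat_sum)
  also have "\<dots> \<le> (\<Sum>\<tau>\<in>T'. ?K * ?q powr (- (n * e)) * card F)"
  proof (rule sum_mono)
    fix \<tau> assume \<tau>: "\<tau> \<in> T'"
    have "card (?X \<tau>) * ?q ^ (k' - k) \<le> ?K * card F"
    proof (rule card_contains_type_le[OF k'(3) kk' k'(1)])
      fix C :: "'a vec set" assume "linear_code n C" "C \<in> P"
      thus "\<forall>B\<in>matrices_of_type n l \<tau>. \<not> columns_in B C" using T \<tau> by (auto simp: T'_def)
    qed
    hence "real (card (?X \<tau>) * ?q ^ (k' - k)) \<le> real (?K * card F)" by (simp only: of_nat_le_iff)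
    hence "real (card (?X \<tau>)) * ?q powr (real k' - real k) \<le> ?K * card F"
      using q kk' by (simp add: powr_realpow of_nat_diff flip: of_nat_diff)
    moreover have "real (card (?X \<tau>)) * ?q powr (n * e) \<le> real (card (?X \<tau>)) * ?q powr (real k' - real k)"
      using ke q by (intro mult_left_mono powr_mono) auto
    ultimately have "real (card (?X \<tau>)) * ?q powr (n * e) \<le> ?K * card F" by linarith
    thus "real (card (?X \<tau>)) \<le> ?K * ?q powr (- (n * e)) * card F"
      using q by (simp add: powr_minus field_simps)
  qed
  also have "\<dots> = card T' * (?K * ?q powr (- (n * e)) * card F)" by simp
  also have "\<dots> \<le> real ((n + 1) ^ (?q ^ l)) * (?K * ?q powr (- (n * e)) * card F)"
    by (rule mult_right_mono[OF cardT']) simp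
  finally show "real (card {f \<in> F. pclp_code f \<notin> P})
    \<le> real ((n + 1) ^ (CARD('a) ^ l) * type_const CARD('a) l) * CARD('a) powr (- (n * e)) * card F"
    by (simp add: mult_ac)
qed

text \<open>With radius h^(-1)(R - e) the ball has at most q^(n(R-e)) words, and each nonzero word
  is in the dual code with probability q^(-k). As k = n R, the union bound is q^(-n e).\<close>

lemma card_dual_distance_defect_le:
  fixes e :: real
  assumes e: "0 < e" "e \<le> real k / real n"
  shows "real (card {f \<in> F. \<not> ereal (qary_entropy_inv CARD('a) (real k / real n - e))
        \<le> min_distance n (dual_code n (pclp_code f))})
    \<le> CARD('a) powr (- (n * e)) * card F"
proof -
  let ?q = "CARD('a)" and ?r = "real k / real n - e"
  let ?d = "qary_entropy_inv CARD('a) ?r"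
  let ?X = "{f \<in> F. \<not> ereal ?d \<le> min_distance n (dual_code n (pclp_code f))}"
  have q: "1 < ?q" by (rule card_field_gt_1)
  have "real k / real n \<le> 1" using k by simp
  hence r: "0 \<le> ?r" "?r \<le> 1" using e by auto
  have d: "?d \<in> {0..1 - 1 / real ?q}" "qary_entropy ?q ?d = ?r"
    using qary_entropy_inv[OF q r] by auto
  define Y where "Y = {y \<in> (carrier_vec n :: 'a vec set). real (card {i. i < n \<and> y $ i \<noteq> 0}) < ?d * n} - {0\<^sub>v n}"
  have finY: "finite Y" unfolding Y_def by simp
  have "card Y \<le> card {y \<in> (carrier_vec n :: 'a vec set). real (card {i. i < n \<and> y $ i \<noteq> 0}) < ?d * n}"
    unfolding Y_def by (intro card_mono) auto
  hence cardY: "real (card Y) \<le> ?q powr (n * ?r)"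
    using card_hamming_ball_le[OF refl, of ?d n, where ?'a = 'a] d by simp
  have "?X \<subseteq> (\<Union>y\<in>Y. {f \<in> F. y \<in> dual_code n (pclp_code f)})"
  proof
    fix f assume f: "f \<in> ?X"
    \<comment> \<open>An infimum below the radius yields an actual light word; a trivial dual code
      has distance infinity and is never counted as bad.\<close>
    hence "\<not> (\<forall>y\<in>dual_code n (pclp_code f) - {0\<^sub>v n}. ereal ?d \<le> ereal (rel_hamming_dist n y (0\<^sub>v n)))"
      by (simp add: min_distance_def le_INF_iff)
    then obtain y where y: "y \<in> dual_code n (pclp_code f)" "y \<noteq> 0\<^sub>v n" "rel_hamming_dist n y (0\<^sub>v n) < ?d"
      by (auto simp: not_le)
    have "{i. i < n \<and> y $ i \<noteq> 0\<^sub>v n $ i} = {i. i < n \<and> y $ i \<noteq> 0}" by auto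
    hence "real (card {i. i < n \<and> y $ i \<noteq> 0}) / n < ?d"
      using y(3) unfolding rel_hamming_dist_def by (simp only:)
    hence "real (card {i. i < n \<and> y $ i \<noteq> 0}) < ?d * n" using n_pos by (simp add: field_simps)
    hence "y \<in> Y" using y(1,2) by (simp add: Y_def dual_code_def)
    thus "f \<in> (\<Union>y\<in>Y. {f \<in> F. y \<in> dual_code n (pclp_code f)})" using f y(1) by blast
  qed
  hence "card ?X \<le> card (\<Union>y\<in>Y. {f \<in> F. y \<in> dual_code n (pclp_code f)})"
    by (intro card_mono finite_UN_I finY) simp
  also have "\<dots> \<le> (\<Sum>y\<in>Y. card {f \<in> F. y \<in> dual_code n (pclp_code f)})"
    by (rule card_UN_le[OF finY])
  finally have "card ?X * ?q ^ k \<le> (\<Sum>y\<in>Y. card {f \<in> F. y \<in> dual_code n (pclp_code f)} * ?q ^ k)"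
    by (simp flip: sum_distrib_right)
  also have "\<dots> = (\<Sum>y\<in>Y. card F)"
    by (intro sum.cong refl card_dual_contains) (auto simp: Y_def)
  finally have "card ?X * ?q ^ k \<le> card Y * card F" by simp
  hence "real (card ?X * ?q ^ k) \<le> real (card Y * card F)" by (simp only: of_nat_le_iff)
  also have "\<dots> \<le> ?q powr (n * ?r) * card F" using cardY by (simp add: mult_right_mono)
  also have "n * ?r = k - n * e" using n_pos by (simp add: algebra_simps)
  also have "?q powr (k - n * e) = ?q powr (- (n * e)) * ?q ^ k"
    using q by (simp add: powr_diff powr_minus powr_realpow field_simps)
  finally have "real (card ?X) * real (?q ^ k) \<le> (?q powr (- (n * e)) * card F) * real (?q ^ k)"
    by (simp add: mult_ac)
  moreover have "0 < real (?q ^ k)" using q by simp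
  ultimately show ?thesis by (rule mult_right_le_imp_le)
qed

lemma card_rate_defect_le:
  "real (card {f \<in> F. code_rate n (pclp_code f) \<noteq> real k / real n})
    \<le> CARD('a) powr (- (1 - real k / real n) * real n) * card F"
proof -
  let ?q = "CARD('a)" and ?X = "{f \<in> F. code_rate n (pclp_code f) \<noteq> real k / real n}"
  have q: "1 < ?q" by (rule card_field_gt_1)
  have "card ?X \<le> card {f \<in> F. code_dim n (pclp_code f) \<noteq> k}"
    by (intro card_mono) (auto simp: code_rate_def)
  hence "card ?X * ?q ^ (n - k) \<le> card {f \<in> F. code_dim n (pclp_code f) \<noteq> k} * ?q ^ (n - k)"
    by (rule mult_le_mono1)
  also have "\<dots> \<le> card F" by (rule card_dim_defect_le)
  finally have "real (card ?X * ?q ^ (n - k)) \<le> real (card F)" by (simp only: of_nat_le_iff)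
  hence "real (card ?X) \<le> card F / ?q ^ (n - k)" using q by (simp add: field_simps)
  also have "- (1 - real k / real n) * real n = - real (n - k)"
    using k n_pos by (simp add: of_nat_diff algebra_simps)
  hence "card F / ?q ^ (n - k) = ?q powr (- (1 - real k / real n) * real n) * card F"
    using q by (simp only: powr_minus powr_realpow of_nat_0_less_iff card_field_pos) (simp add: field_simps)
  finally show ?thesis .
qed

end

section \<open>Choice of the error term and combination of the three bounds\<close>

theorem theorem3p4:
  fixes q l :: nat
  assumes "q = CARD('a::finite_field)" and "l \<ge> 1"
  shows "\<exists>\<delta> :: nat \<Rightarrow> real. \<delta> \<longlonglongrightarrow> 0 \<and>
    (\<forall>(n::nat) (k::nat) (V :: 'a alg_closure set) (\<alpha> :: nat \<Rightarrow> 'a alg_closure) (R::real) (\<epsilon>::real).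
       1 \<le> k \<and> k \<le> n \<and> R = real k / real n \<and> \<epsilon> > 0 \<and>
       V \<subseteq> ext_field n \<and> ac.subspace V \<and> ac.dim V = k \<and> adapted_basis n k V \<alpha> \<longrightarrow>
       (\<forall>P. local_property n l P \<and> R \<le> threshold_rate n P - \<epsilon> \<longrightarrow>
          measure_pmf.prob (PCLP n l V \<alpha>) {C. C \<in> P}
            \<ge> 1 - real q powr (- real n * (\<epsilon> - \<delta> n))) \<and>
       (\<epsilon> \<le> R \<longrightarrow>
          measure_pmf.prob (PCLP n l V \<alpha>)
              {C. min_distance n (dual_code n C) \<ge> ereal (qary_entropy_inv q (R - \<epsilon>))}
            \<ge> 1 - real q powr (- real n * (\<epsilon> - \<delta> n))) \<and>
       measure_pmf.prob (PCLP n l V \<alpha>) {C. code_rate n C = R}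
         \<ge> 1 - real q powr (- (1 - R) * real n) \<and>
       (\<forall>P. local_property n l P \<and> R \<le> threshold_rate n P - \<epsilon> \<and> \<epsilon> \<le> R \<longrightarrow>
          measure_pmf.prob (PCLP n l V \<alpha>)
              {C. C \<in> P \<and>
                  min_distance n (dual_code n C) \<ge> ereal (qary_entropy_inv q (R - \<epsilon>)) \<and>
                  code_rate n C = R}
            \<ge> 1 - real q powr (- real n * (\<epsilon> - \<delta> n))))"
proof -
  define K where "K = type_const q l"
  \<comment> \<open>The factor covers the number of types times \<open>K\<close>, and the summand 2
    leaves room for the dual distance and rate failures in the combined statement.\<close>
  define c where "c n = real ((n + 1) ^ (q ^ l)) * (K + 2)" for n
  \<comment> \<open>Chosen so that q^(n \<delta>(n)) = c(n) for positive n; as c(n) is polynomial in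
    n, this tends to 0. It depends on q and l only.\<close>
  define \<delta> where "\<delta> n = log q (c n) / n" for n
  have q: "1 < q" unfolding assms(1) by (rule card_field_gt_1)
  have c_pos: "0 < c n" for n unfolding c_def by simp
  have lim: "\<delta> \<longlonglongrightarrow> 0"
  proof -
    have "(\<lambda>n. ln (real n + 1) / real n) \<longlonglongrightarrow> 0" "(\<lambda>n. 1 / real n) \<longlonglongrightarrow> 0" by real_asymp+
    hence "(\<lambda>n. real (q ^ l) / ln q * (ln (real n + 1) / real n) + ln (K + 2) / ln q * (1 / real n))
        \<longlonglongrightarrow> real (q ^ l) / ln q * 0 + ln (K + 2) / ln q * 0"
      by (intro tendsto_intros)
    moreover have "\<delta> = (\<lambda>n. real (q ^ l) / ln q * (ln (real n + 1) / real n) + ln (K + 2) / ln q * (1 / real n))"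
      by (rule ext) (simp add: \<delta>_def c_def log_def ln_mult ln_realpow add_divide_distrib add_ac)
    ultimately show ?thesis by (simp only: mult_zero_right add_0_right)
  qed
  have shift: "q powr (- real n * (e - \<delta> n)) = c n * q powr (- (n * e))" if "0 < n" for n e
  proof -
    have "- real n * (e - \<delta> n) = log q (c n) + - (n * e)"
      using that by (simp add: \<delta>_def algebra_simps)
    thus ?thesis using q c_pos[of n] by (simp only: powr_add) simp
  qed
  have c_large: "real ((n + 1) ^ (q ^ l) * K) + 2 \<le> c n" for n
  proof -
    have "1 \<le> (n + 1) ^ (q ^ l)" by simp
    hence "real 1 \<le> real ((n + 1) ^ (q ^ l))" by (simp only: of_nat_le_iff)
    moreover have "a * K + 2 \<le> a * (K + 2)" if "real 1 \<le> a" for a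
      using that by (simp add: distrib_left)
    ultimately show ?thesis unfolding c_def of_nat_mult by blast
  qed
  show ?thesis
  proof (intro exI[of _ \<delta>] conjI[OF lim] allI impI)
    fix n k :: nat and V :: "'a alg_closure set" and \<alpha> :: "nat \<Rightarrow> 'a alg_closure" and R e :: real
    assume "1 \<le> k \<and> k \<le> n \<and> R = real k / real n \<and> e > 0 \<and>
       V \<subseteq> ext_field n \<and> ac.subspace V \<and> ac.dim V = k \<and> adapted_basis n k V \<alpha>"
    hence R: "R = real k / real n" and e: "0 < e" and pclp: "pclp n k l V \<alpha>"
      using assms(2) by (auto intro: pclp.intro)
    interpret pclp n k l V \<alpha> by (rule pclp)
    let ?d = "ereal (qary_entropy_inv q (R - e))"
    let ?p = "q powr (- (n * e))"
    let ?X1 = "\<lambda>P. {f \<in> F. pclp_code f \<notin> P}"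
    let ?X2 = "{f \<in> F. \<not> ?d \<le> min_distance n (dual_code n (pclp_code f))}"
    let ?X3 = "{f \<in> F. code_rate n (pclp_code f) \<noteq> R}"
    have fail1: "real (card (?X1 P)) \<le> real ((n + 1) ^ (q ^ l) * K) * ?p * card F"
      and e1: "e \<le> 1 - R"
      if "local_property n l P" "R \<le> threshold_rate n P - e" for P :: "'a vec set set"
      using card_not_local_property_le[OF that(1) e that(2)[unfolded R]] by (simp_all add: K_def assms(1) R)
    have fail2: "real (card ?X2) \<le> ?p * card F" if "e \<le> R"
      using card_dual_distance_defect_le[OF e that[unfolded R]] by (simp add: assms(1) R)
    have fail3: "real (card ?X3) \<le> q powr (- (1 - R) * n) * card F"
      using card_rate_defect_le by (simp add: assms(1) R)
    have absorb: "a * ?p * card F \<le> q powr (- real n * (e - \<delta> n)) * card F"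
      if "a \<le> real ((n + 1) ^ (q ^ l) * K) + 2" for a
      unfolding shift[OF n_pos] using that c_large[of n] by (intro mult_right_mono) auto
    show "(\<forall>P. local_property n l P \<and> R \<le> threshold_rate n P - e \<longrightarrow>
          measure_pmf.prob (PCLP n l V \<alpha>) {C. C \<in> P}
            \<ge> 1 - real q powr (- real n * (e - \<delta> n))) \<and>
       (e \<le> R \<longrightarrow>
          measure_pmf.prob (PCLP n l V \<alpha>)
              {C. min_distance n (dual_code n C) \<ge> ?d}
            \<ge> 1 - real q powr (- real n * (e - \<delta> n))) \<and>
       measure_pmf.prob (PCLP n l V \<alpha>) {C. code_rate n C = R}
         \<ge> 1 - real q powr (- (1 - R) * real n) \<and>
       (\<forall>P. local_property n l P \<and> R \<le> threshold_rate n P - e \<and> e \<le> R \<longrightarrow>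
          measure_pmf.prob (PCLP n l V \<alpha>)
              {C. C \<in> P \<and> min_distance n (dual_code n C) \<ge> ?d \<and> code_rate n C = R}
            \<ge> 1 - real q powr (- real n * (e - \<delta> n)))"
    proof (intro conjI allI impI; (elim conjE)?)
      fix P :: "'a vec set set" assume P: "local_property n l P" "R \<le> threshold_rate n P - e"
      show "measure_pmf.prob (PCLP n l V \<alpha>) {C. C \<in> P} \<ge> 1 - real q powr (- real n * (e - \<delta> n))"
        by (rule prob_PCLP_ge) (use fail1[OF P] absorb[of "real ((n + 1) ^ (q ^ l) * K)"] in simp)
    next
      assume "e \<le> R"
      thus "measure_pmf.prob (PCLP n l V \<alpha>) {C. min_distance n (dual_code n C) \<ge> ?d}
          \<ge> 1 - real q powr (- real n * (e - \<delta> n))"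
        by (intro prob_PCLP_ge) (use fail2 absorb[of 1] in simp)
    next
      show "measure_pmf.prob (PCLP n l V \<alpha>) {C. code_rate n C = R} \<ge> 1 - real q powr (- (1 - R) * real n)"
        by (rule prob_PCLP_ge) (use fail3 in simp)
    next
      fix P :: "'a vec set set" assume P: "local_property n l P" "R \<le> threshold_rate n P - e" and eR: "e \<le> R"
      \<comment> \<open>The rate failure probability q^(-(1-R)n) is at most q^(-n e), because the
        existence of \<open>P\<close> with this threshold forces e \<le> 1 - R.\<close>
      have "n * e \<le> n * (1 - R)" using e1[OF P] by (intro mult_left_mono) auto
      hence "- (1 - R) * n \<le> - (n * e)" by (simp add: algebra_simps)
      hence "q powr (- (1 - R) * n) * card F \<le> ?p * card F"
        using q by (intro mult_right_mono powr_mono) auto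
      hence fail3': "real (card ?X3) \<le> ?p * card F" using fail3 by linarith
      have "{f \<in> F. pclp_code f \<notin> {C. C \<in> P \<and> min_distance n (dual_code n C) \<ge> ?d \<and> code_rate n C = R}}
          \<subseteq> ?X1 P \<union> (?X2 \<union> ?X3)" by auto
      hence "card {f \<in> F. pclp_code f \<notin> {C. C \<in> P \<and> min_distance n (dual_code n C) \<ge> ?d \<and> code_rate n C = R}}
          \<le> card (?X1 P \<union> (?X2 \<union> ?X3))" by (intro card_mono) auto
      also have "\<dots> \<le> card (?X1 P) + (card ?X2 + card ?X3)"
        by (meson add_left_mono card_Un_le order.trans)
      finally have "real (card {f \<in> F. pclp_code f \<notin> {C. C \<in> P \<and> min_distance n (dual_code n C) \<ge> ?d \<and> code_rate n C = R}})
          \<le> real (card (?X1 P)) + (real (card ?X2) + real (card ?X3))" by linarith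
      also have "\<dots> \<le> (real ((n + 1) ^ (q ^ l) * K) + 2) * ?p * card F"
        using fail1[OF P] fail2[OF eR] fail3' by (simp add: algebra_simps)
      also have "\<dots> \<le> q powr (- real n * (e - \<delta> n)) * card F" by (rule absorb) simp
      finally show "measure_pmf.prob (PCLP n l V \<alpha>)
              {C. C \<in> P \<and> min_distance n (dual_code n C) \<ge> ?d \<and> code_rate n C = R}
            \<ge> 1 - real q powr (- real n * (e - \<delta> n))"
        by (rule prob_PCLP_ge)
    qed
  qed
qed

end
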